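(* Let $n\ge0$ (with $n\le p-1$ if $\operatorname{char}(K)=p>0$), $f\in C^n(R,K)$, $a\in R$, $c\in K$ and $\delta,\varepsilon>0$. Suppose that $\left|\psi_{n-j}D_jf(r,r_-)-\binom{n+1}{j}c\right|<\varepsilon$ for every $0\le j\le n$ and every $r\in\mathcal{R}_+$ with $|r-a|<\delta$ and $|r_--a|<\delta$. Then $|\psi_nf(x,y)-c|<\varepsilon$ for all distinct $x,y\in R$ with $|x-a|<\delta$ and $|y-a|<\delta$.
   Context: $K$ is a local field: the fraction field of a complete discrete valuation ring $R$ with finite residue field $\kappa$ of cardinality $q$. Fix a uniformizer $\pi$, $|\pi|=q^{-1}$, and a set $\mathcal{T}\subset R$ of representatives of $\kappa$ containing $0$; every $x\in R$ has a unique expansion $\sum_{i\ge0}a_i\pi^i$, $a_i\in\mathcal{T}$. Let $\mathcal{R}_m=\{\sum_{i=0}^{m-1}a_i\pi^i: a_i\in\mathcal{T}\}$ ($m\ge1$), $\mathcal{R}_+=\bigcup_{m\ge1}\mathcal{R}_m$. For $r\in\mathcal{R}_+$ written $r=\sum_{i=0}^{m}a_i\pi^i$, $a_m\neq0$, put $r_-=\sum_{i=0}^{m-1}a_i\pi^i$. Difference quotients: $\nabla^kR=\{(x_1,\dots,x_k)\in R^k$ pairwise distinct$\}$; $\Phi_0f=f$, $\Phi_kf(x_1,\dots,x_{k+1})=\frac{\Phi_{k-1}f(x_1,x_3,\dots,x_{k+1})-\Phi_{k-1}f(x_2,x_3,\dots,x_{k+1})}{x_1-x_2}$ on $\nabla^{k+1}R$.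 $f$ is $C^k$ if $\Phi_kf$ extends continuously to $R^{k+1}$; $C^k(R,K)$ the set of such. For $f\in C^k$ and $j\le k$, $D_jf(x)=\Phi_jf(x,\dots,x)$ and $D_jf\in C^{k-j}$. For $f\in C^k$ and $0\le j\le k$, $\psi_jf:\nabla^2R\to K$ is $\psi_0f=\Phi_1f$, $\psi_jf(x,y)=\frac{f(x)-f(y)-\sum_{l=1}^j(x-y)^lD_lf(y)}{(x-y)^{j+1}}$. *)

theory Defs
  imports "HOL-Analysis.Analysis"
begin

text \<open>
  The library's \<open>norm\<close> is reserved for spaces over the reals, hence a separate
  symbol for the absolute value. It induces the metric and thereby the topology.
\<close>

class complete_nonarch_field = field + complete_space +
  fixes absval :: "'a \<Rightarrow> real"
  assumes dist_absval: "dist x y = absval (x - y)"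
    and absval_mult: "absval (x * y) = absval x * absval y"
    and absval_ultrametric: "absval (x + y) \<le> max (absval x) (absval y)"

definition (in complete_nonarch_field) valuation_ring :: "'a set" where
  "valuation_ring = {x. absval x \<le> 1}"

text \<open>The maximal ideal of the valuation ring is \<open>{x. absval x < 1}\<close>.\<close>

definition (in complete_nonarch_field) residue_field :: "'a set set" where
  "residue_field = valuation_ring //
     {(x, y). x \<in> valuation_ring \<and> y \<in> valuation_ring \<and> absval (x - y) < 1}"

text \<open>
  With \<open>q\<close> the cardinality of the residue field, the value group is \<open>q\<^sup>\<int>\<close>: this makes
  \<open>valuation_ring\<close> a complete discrete valuation ring whose fraction field is the given field,
  and it normalizes the absolute value so that uniformizers have absolute value \<open>1 / q\<close>.
\<close>

class local_field = complete_nonarch_field +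
  assumes finite_residue_field: "finite residue_field"
    and value_group:
      "absval ` (UNIV - {0}) =
         range (\<lambda>k::int. real (card residue_field) powi k)"

definition uniformizer :: "'a::local_field \<Rightarrow> bool" where
  "uniformizer \<pi> \<longleftrightarrow> {x. absval x < 1} = (\<lambda>x. \<pi> * x) ` valuation_ring"

definition residue_representatives :: "'a::local_field set \<Rightarrow> bool" where
  "residue_representatives T \<longleftrightarrow>
     T \<subseteq> valuation_ring \<and> (\<forall>X\<in>residue_field. \<exists>!t. t \<in> T \<and> t \<in> X)"

definition finite_expansions :: "'a::local_field \<Rightarrow> 'a set \<Rightarrow> nat \<Rightarrow> 'a set" where
  "finite_expansions \<pi> T m = {\<Sum>i<m. a i * \<pi> ^ i | a. \<forall>i<m. a i \<in> T}"

definition R_plus :: "'a::local_field \<Rightarrow> 'a set \<Rightarrow> 'a set" where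
  "R_plus \<pi> T = (\<Union>m\<in>{1..}. finite_expansions \<pi> T m)"

text \<open>
  Removal of the leading (highest) digit of a finite expansion. The element \<open>0\<close> has no
  leading digit, so \<open>remove_leading \<pi> T 0\<close> carries no meaning.
\<close>

definition remove_leading :: "'a::local_field \<Rightarrow> 'a set \<Rightarrow> 'a \<Rightarrow> 'a" where
  "remove_leading \<pi> T r =
     (THE s. \<exists>m a. (\<forall>i\<le>m. a i \<in> T) \<and> a m \<noteq> 0 \<and>
        r = (\<Sum>i\<le>m. a i * \<pi> ^ i) \<and> s = (\<Sum>i<m. a i * \<pi> ^ i))"

text \<open>
  A tuple \<open>(x\<^sub>1, \<dots>, x\<^sub>k)\<close> is a function on the indices \<open>0, \<dots>, k - 1\<close>, extended by
  \<open>undefined\<close>.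
\<close>

definition nabla :: "nat \<Rightarrow> (nat \<Rightarrow> 'a::local_field) set" where
  "nabla k = {x \<in> {..<k} \<rightarrow>\<^sub>E valuation_ring. inj_on x {..<k}}"

text \<open>
  In the recursion, the two arguments are the tuples with the second, respectively the first,
  entry deleted.
\<close>

primrec diff_quot :: "nat \<Rightarrow> ('a::local_field \<Rightarrow> 'a) \<Rightarrow> (nat \<Rightarrow> 'a) \<Rightarrow> 'a" where
  "diff_quot 0 f x = f (x 0)"
| "diff_quot (Suc k) f x =
     (diff_quot k f (\<lambda>i. if i = 0 then x 0 else x (Suc i)) - diff_quot k f (\<lambda>i. x (Suc i)))
       / (x 0 - x 1)"

definition continuous_extension ::
    "nat \<Rightarrow> ('a::local_field \<Rightarrow> 'a) \<Rightarrow> ((nat \<Rightarrow> 'a) \<Rightarrow> 'a) \<Rightarrow> bool" where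
  "continuous_extension k f g \<longleftrightarrow>
     continuous_map (product_topology (\<lambda>_. top_of_set valuation_ring) {..<Suc k}) euclidean g \<and>
     (\<forall>x\<in>nabla (Suc k). g x = diff_quot k f x)"

text \<open>
  Functions on the valuation ring are represented by total functions; their values outside the
  valuation ring play no role.
\<close>

definition C_fun :: "nat \<Rightarrow> ('a::local_field \<Rightarrow> 'a) set" where
  "C_fun k = {f. \<exists>g. continuous_extension k f g}"

text \<open>
  The extension is unique on tuples in the valuation ring, because the tuples with pairwise
  distinct entries are dense there.
\<close>

definition ext_diff_quot :: "nat \<Rightarrow> ('a::local_field \<Rightarrow> 'a) \<Rightarrow> (nat \<Rightarrow> 'a) \<Rightarrow> 'a" where
  "ext_diff_quot k f = (SOME g. continuous_extension k f g)"

definition D :: "nat \<Rightarrow> ('a::local_field \<Rightarrow> 'a) \<Rightarrow> 'a \<Rightarrow> 'a" where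
  "D j f x = ext_diff_quot j f (\<lambda>i\<in>{..<Suc j}. x)"

text \<open>For \<open>j = 0\<close> the sum is empty and this is the first difference quotient.\<close>

definition psi :: "nat \<Rightarrow> ('a::local_field \<Rightarrow> 'a) \<Rightarrow> 'a \<Rightarrow> 'a \<Rightarrow> 'a" where
  "psi j f x y = (f x - f y - (\<Sum>l=1..j. (x - y) ^ l * D l f y)) / (x - y) ^ (j + 1)"

end

theory Submission
  imports Defs "HOL-Combinatorics.Permutations"
begin

text \<open>
  Put \<open>U\<^sub>y(X) = (\<Sum>l\<le>n. D\<^sub>l f(y) (X - y)\<^sup>l) + c (X - y)\<^sup>n\<^sup>+\<^sup>1\<close>. Then
  \<open>(\<psi>\<^sub>n f(x, y) - c) (x - y)\<^sup>n\<^sup>+\<^sup>1 = U\<^sub>x(x) - U\<^sub>y(x)\<close>, and \<open>U\<^sub>x - U\<^sub>y\<close> expanded in powers of \<open>X - x\<close>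
  has the \<open>j\<close>-th coefficient
  \<open>(\<psi>\<^sub>n\<^sub>-\<^sub>j D\<^sub>j f(x, y) - binom(n + 1, j) c) (x - y)\<^sup>n\<^sup>+\<^sup>1\<^sup>-\<^sup>j\<close>, because
  \<open>D\<^sub>l D\<^sub>j f = binom(j + l, j) D\<^sub>j\<^sub>+\<^sub>l f\<close>. Since the differences \<open>U\<^sub>x - U\<^sub>y\<close> are additive along chains, two
  finite expansions can be joined through their longest common prefix by removing leading digits one
  at a time; each step is controlled by the hypothesis, all nodes stay within \<open>|x - y|\<close> of \<open>x\<close>, and
  the ultrametric inequality keeps the bound strict. Arbitrary \<open>x \<noteq> y\<close> follow by continuity.

  The identity for \<open>D\<^sub>l D\<^sub>j\<close> comes from
  \<open>\<Phi>\<^sub>k(D\<^sub>1 f)(y\<^sub>0, \<dots>, y\<^sub>k) = (\<Sum>i\<le>k. \<Phi>\<^sub>k\<^sub>+\<^sub>1 f(y\<^sub>i, y\<^sub>0, \<dots>, y\<^sub>k))\<close>, where the right-hand side means the continuous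
  extension, by iterating \<open>D\<^sub>1\<close> and dividing by factors at most \<open>n\<close>, hence nonzero in the field.
\<close>

subsection \<open>Non-archimedean fields\<close>

lemma absval_zero [simp]: "absval (0::'a::complete_nonarch_field) = 0"
  using dist_absval[of "0::'a" 0] by simp

lemma absval_nonneg [simp]: "absval (x::'a::complete_nonarch_field) \<ge> 0"
  using dist_absval[of x 0] by (metis diff_zero zero_le_dist)

lemma absval_eq_0_iff [simp]: "absval (x::'a::complete_nonarch_field) = 0 \<longleftrightarrow> x = 0"
  using dist_absval[of x 0] by (metis diff_zero dist_eq_0_iff)

lemma absval_pos_iff [simp]: "absval (x::'a::complete_nonarch_field) > 0 \<longleftrightarrow> x \<noteq> 0"
  by (metis absval_eq_0_iff absval_nonneg order_less_le)

lemma absval_one [simp]: "absval (1::'a::complete_nonarch_field) = 1"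
  using absval_mult[of "1::'a" 1] by simp

lemma absval_minus [simp]: "absval (- x::'a::complete_nonarch_field) = absval x"
  by (metis diff_0 diff_zero dist_absval dist_commute)

lemma absval_minus_commute: "absval (x - y::'a::complete_nonarch_field) = absval (y - x)"
  by (metis absval_minus minus_diff_eq)

lemma absval_diff_le: "absval (x - y::'a::complete_nonarch_field) \<le> max (absval x) (absval y)"
  using absval_ultrametric[of x "- y"] by simp

lemma absval_power: "absval (x ^ n::'a::complete_nonarch_field) = absval x ^ n"
  by (induction n) (auto simp: absval_mult)

lemma absval_divide: "absval (x / y::'a::complete_nonarch_field) = absval x / absval y"
proof (cases "y = 0")
  case False
  then have "absval (x / y) * absval y = absval x"
    by (metis absval_mult nonzero_eq_divide_eq)
  with False show ?thesis
    by (simp add: field_simps)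
qed simp

lemma absval_add_less:
  "absval x < e \<Longrightarrow> absval y < e \<Longrightarrow> absval (x + y::'a::complete_nonarch_field) < e"
  using absval_ultrametric[of x y] by linarith

lemma absval_diff_less:
  "absval x < e \<Longrightarrow> absval y < e \<Longrightarrow> absval (x - y::'a::complete_nonarch_field) < e"
  using absval_diff_le[of x y] by linarith

lemma absval_sum_less:
  fixes g :: "'i \<Rightarrow> 'a::complete_nonarch_field"
  assumes "e > 0" "\<And>i. i \<in> I \<Longrightarrow> absval (g i) < e"
  shows "absval (sum g I) < e"
  using assms(2)
  by (induction I rule: infinite_finite_induct) (auto simp: assms(1) intro: absval_add_less)

lemma absval_add_le:
  "absval x \<le> e \<Longrightarrow> absval y \<le> e \<Longrightarrow> absval (x + y::'a::complete_nonarch_field) \<le> e"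
  using absval_ultrametric[of x y] by linarith

text \<open>Isosceles triangles: since \<open>x = (x + y) - y\<close>, the inequality
  \<open>absval (x + y) < absval x\<close> would contradict the ultrametric inequality.\<close>

lemma absval_add_eq:
  assumes "absval y < absval (x::'a::complete_nonarch_field)"
  shows "absval (x + y) = absval x"
  using assms absval_ultrametric[of x y] absval_diff_le[of "x + y" y] by auto

section \<open>The field topology and continuity of the operations\<close>

lemma tendsto_absval_iff:
  fixes u :: "'i \<Rightarrow> 'a::complete_nonarch_field"
  shows "(u \<longlongrightarrow> l) F \<longleftrightarrow> (\<forall>e>0. eventually (\<lambda>i. absval (u i - l) < e) F)"
  by (simp add: tendsto_iff dist_absval)

lemma eventually_nhds_absval:
  "eventually (\<lambda>x. absval (x - a::'a::complete_nonarch_field) < e) (nhds a)" if "e > 0"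
  using that by (auto simp: eventually_nhds_metric dist_absval intro!: exI[of _ e])

instance complete_nonarch_field \<subseteq> topological_ab_group_add
proof
  fix a b :: 'a
  show "LIM x nhds a \<times>\<^sub>F nhds b. fst x + snd x :> nhds (a + b)"
    unfolding tendsto_absval_iff
  proof (intro allI impI)
    fix e :: real assume "e > 0"
    from eventually_prodI[OF eventually_nhds_absval[OF this, of a]
        eventually_nhds_absval[OF this, of b]]
    show "\<forall>\<^sub>F x in nhds a \<times>\<^sub>F nhds b. absval (fst x + snd x - (a + b)) < e"
    proof eventually_elim
      case (elim x)
      then show ?case
        using absval_add_less[of "fst x - a" e "snd x - b"] by (simp add: algebra_simps)
    qed
  qed
  show "(uminus \<longlongrightarrow> - a) (nhds a)"
    unfolding tendsto_absval_iff
  proof (intro allI impI)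
    fix e :: real assume "e > 0"
    from eventually_nhds_absval[OF this, of a]
    show "\<forall>\<^sub>F x in nhds a. absval (- x - - a) < e"
      by eventually_elim (simp add: absval_minus_commute)
  qed
qed

instance complete_nonarch_field \<subseteq> topological_comm_monoid_mult
proof
  fix a b :: 'a
  show "LIM x nhds a \<times>\<^sub>F nhds b. fst x * snd x :> nhds (a * b)"
    unfolding tendsto_absval_iff
  proof (intro allI impI)
    fix e :: real assume e: "e > 0"
    \<comment> \<open>The bound 1 controls the product of the two errors; the quotient makes
      \<open>d\<close>, \<open>d * absval a\<close> and \<open>d * absval b\<close> sum to at most
      \<open>e\<close>.\<close>
    define d where "d = min 1 (e / (1 + absval a + absval b))"
    have pos: "1 + absval a + absval b > 0"
      using absval_nonneg[of a] absval_nonneg[of b] by linarith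
    have d: "d > 0" "d \<le> 1"
      using e pos by (auto simp: d_def)
    have d3: "d * (1 + absval a + absval b) \<le> e"
      unfolding pos_le_divide_eq[OF pos, symmetric] d_def by simp
    from eventually_prodI[OF eventually_nhds_absval[OF d(1), of a]
        eventually_nhds_absval[OF d(1), of b]]
    show "\<forall>\<^sub>F x in nhds a \<times>\<^sub>F nhds b. absval (fst x * snd x - a * b) < e"
    proof eventually_elim
      case (elim x)
      let ?u = "fst x - a" and ?v = "snd x - b"
      have e': "d + d * absval a + d * absval b \<le> e"
        using d3 by (simp add: algebra_simps)
      have nn: "d * absval a \<ge> 0" "d * absval b \<ge> 0"
        using d by auto
      have "absval (?u * ?v) \<le> absval ?u * 1"
        unfolding absval_mult using elim d by (intro mult_left_mono) auto
      then have 1: "absval (?u * ?v) < e"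
        using elim nn e' by simp
      have 2: "absval (a * ?v) < e"
        unfolding absval_mult using elim nn e' d mult_left_mono[OF less_imp_le[OF conjunct2[OF elim]] absval_nonneg[of a]]
        by (simp only: mult.commute[of d])
      have 3: "absval (?u * b) < e"
        unfolding absval_mult using elim nn e' d mult_right_mono[OF less_imp_le[OF conjunct1[OF elim]] absval_nonneg[of b]]
        by linarith
      have "fst x * snd x - a * b = ?u * ?v + a * ?v + ?u * b"
        by (simp add: algebra_simps)
      then show ?case
        using 1 2 3 by (simp add: absval_add_less)
    qed
  qed
qed

section \<open>Residue classes and absence of isolated points\<close>

lemma valuation_ring_add:
  "x \<in> valuation_ring \<Longrightarrow> y \<in> valuation_ring \<Longrightarrow> x + y \<in> (valuation_ring :: 'a::complete_nonarch_field set)"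
  by (auto simp: valuation_ring_def intro: absval_add_le)

lemma residue_classI:
  "(x::'a::complete_nonarch_field) \<in> valuation_ring \<Longrightarrow> {y \<in> valuation_ring. absval (x - y) < 1} \<in> residue_field"
  unfolding residue_field_def by (rule quotientI[THEN back_subst[of "\<lambda>X. X \<in> _"]]) auto

text \<open>The classes of 0 and 1 differ because \<open>absval 1 = 1\<close>; hence the value group
  is nontrivial.\<close>

lemma card_residue_field_ge_2: "card (residue_field :: 'a::local_field set set) \<ge> 2"
proof -
  let ?c = "\<lambda>x::'a. {y \<in> valuation_ring. absval (x - y) < 1}"
  have "{?c 0, ?c 1} \<subseteq> residue_field"
    using residue_classI[of "0::'a"] residue_classI[of "1::'a"] by (simp add: valuation_ring_def)
  moreover have "?c 0 \<noteq> ?c 1"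
  proof -
    have "0 \<in> ?c 0" "0 \<notin> ?c 1"
      by (auto simp: valuation_ring_def)
    then show ?thesis
      by blast
  qed
  ultimately show ?thesis
    using card_mono[OF finite_residue_field, of "{?c 0, ?c 1}"] by simp
qed

lemma exists_small_nonzero: "\<exists>x::'a::local_field. x \<noteq> 0 \<and> absval x < 1"
proof -
  let ?q = "real (card (residue_field :: 'a set set))"
  have "?q powi (-1) \<in> absval ` (UNIV - {0::'a})"
    unfolding value_group by blast
  moreover have "?q powi (-1) < 1"
    using card_residue_field_ge_2[where ?'a='a] by (simp add: power_int_minus divide_simps)
  ultimately show ?thesis
    by auto
qed

text \<open>The points \<open>x + p ^ m\<close> with \<open>0 < absval p < 1\<close> approach
  \<open>x\<close> at pairwise different distances. This is what lets distinct nodes approximate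
  coinciding ones.\<close>

lemma infinite_valuation_ring_ball:
  fixes x :: "'a::local_field"
  assumes "x \<in> valuation_ring" "e > 0"
  shows "infinite {y \<in> valuation_ring. absval (y - x) < e}"
proof
  assume fin: "finite {y \<in> valuation_ring. absval (y - x) < e}"
  obtain p :: 'a where p: "p \<noteq> 0" "absval p < 1"
    using exists_small_nonzero by blast
  then have "(\<lambda>m. absval p ^ m) \<longlonglongrightarrow> 0"
    by (intro LIMSEQ_power_zero) auto
  then have "eventually (\<lambda>m. absval p ^ m < e) sequentially"
    using assms(2) by (rule order_tendstoD(2))
  then obtain N where N: "\<And>m. m \<ge> N \<Longrightarrow> absval p ^ m < e"
    by (auto simp: eventually_sequentially)
  have "(\<lambda>m. x + p ^ m) ` {N..} \<subseteq> {y \<in> valuation_ring. absval (y - x) < e}"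
  proof (safe)
    fix m assume "m \<ge> N"
    show "x + p ^ m \<in> valuation_ring"
      using assms(1) p by (intro valuation_ring_add) (auto simp: valuation_ring_def absval_power power_le_one)
    show "absval (x + p ^ m - x) < e"
      using N[OF \<open>m \<ge> N\<close>] by (simp add: absval_power)
  qed
  moreover have "inj_on (\<lambda>m. x + p ^ m) {N..}"
  proof (rule inj_onI)
    fix i j assume "x + p ^ i = x + p ^ j"
    then have "absval p ^ i = absval p ^ j"
      by (metis absval_power add_left_cancel)
    then show "i = j"
      using p power_strict_decreasing_iff[of "absval p" i j] power_strict_decreasing_iff[of "absval p" j i]
      by (metis absval_pos_iff linorder_neqE_nat order_less_irrefl)
  qed
  ultimately show False
    using fin infinite_Ici finite_imageD finite_subset by metis
qed

lemma valuation_ring_approx: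
  fixes x :: "'a::local_field"
  assumes "x \<in> valuation_ring" "e > 0" "finite S"
  obtains y where "y \<in> valuation_ring" "y \<notin> S" "absval (y - x) < e"
proof -
  have "infinite ({y \<in> valuation_ring. absval (y - x) < e} - S)"
    using infinite_valuation_ring_ball[OF assms(1,2)] assms(3) by (simp add: Diff_infinite_finite)
  then have "{y \<in> valuation_ring. absval (y - x) < e} - S \<noteq> {}"
    by (metis finite.emptyI)
  then show ?thesis
    using that by blast
qed

subsection \<open>Divided differences\<close>

text \<open>A list version of \<open>diff_quot\<close>: permuting and exchanging nodes is easier on
  lists than on index functions.\<close>

fun divdiff :: "('a \<Rightarrow> 'a) \<Rightarrow> 'a list \<Rightarrow> 'a::field" where
  "divdiff f [] = 0"
| "divdiff f [x] = f x"
| "divdiff f (x # y # xs) = (divdiff f (x # xs) - divdiff f (y # xs)) / (x - y)"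

lemma diff_quot_eq_divdiff: "diff_quot k f x = divdiff f (map x [0..<Suc k])"
proof (induction k arbitrary: x)
  case (Suc k)
  have eq: "map y [0..<Suc k] = y 0 # map (\<lambda>i. y (Suc i)) [0..<k]" for y :: "nat \<Rightarrow> 'a"
    by (simp add: upt_conv_Cons map_Suc_upt[symmetric] comp_def del: upt_Suc)
  have eq2: "map x [0..<Suc (Suc k)] = x 0 # x 1 # map (\<lambda>i. x (Suc (Suc i))) [0..<k]"
    by (simp add: upt_conv_Cons map_Suc_upt[symmetric] comp_def del: upt_Suc)
  show ?case
    unfolding eq2 by (simp only: diff_quot.simps Suc eq divdiff.simps) simp
qed simp

text \<open>The Lagrange form of the divided difference. It sees the nodes only as a set, which
  yields symmetry in the nodes.\<close>

definition lagrange_sum :: "('a \<Rightarrow> 'a) \<Rightarrow> 'a set \<Rightarrow> 'a::field" where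
  "lagrange_sum f S = (\<Sum>x\<in>S. f x / (\<Prod>y\<in>S - {x}. x - y))"

text \<open>Partial fractions: at a common node \<open>x\<close>,
  \<open>1 / (x - a) - 1 / (x - b) = (a - b) / ((x - a) * (x - b))\<close>; the terms at
  \<open>a\<close> and \<open>b\<close> match directly.\<close>

lemma lagrange_sum_rec:
  assumes "finite A" "a \<noteq> b" "a \<notin> A" "b \<notin> A"
  shows "lagrange_sum f (insert a A) - lagrange_sum f (insert b A)
           = (a - b) * lagrange_sum f (insert a (insert b A))"
proof -
  \<comment> \<open>\<open>P x\<close> runs over the common nodes other than \<open>x\<close>;
    \<open>S c\<close> is their share in the Lagrange sum over \<open>insert c A\<close>.\<close>
  define P where "P = (\<lambda>x. \<Prod>y\<in>A - {x}. x - y)"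
  define S where "S = (\<lambda>c. \<Sum>x\<in>A. f x / ((x - c) * P x))"
  have P_nz: "P x \<noteq> 0" for x
    using assms(1) by (auto simp: P_def prod_zero_iff)
  have single: "lagrange_sum f (insert c A) = f c / P c + S c" if "c \<notin> A" for c
  proof -
    have "(\<Prod>y\<in>insert c A - {x}. x - y) = (x - c) * P x" if "x \<in> A" for x
    proof -
      have "insert c A - {x} = insert c (A - {x})"
        using \<open>c \<notin> A\<close> that by auto
      then show ?thesis
        using assms(1) \<open>c \<notin> A\<close> by (simp add: P_def)
    qed
    moreover have "insert c A - {c} = A - {c}"
      by auto
    ultimately show ?thesis
      unfolding lagrange_sum_def S_def using assms(1) that by (simp add: P_def)
  qed
  have T: "(\<Prod>y\<in>insert a (insert b A) - {x}. x - y) = (x - a) * (x - b) * P x" if "x \<in> A" for x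
  proof -
    have "insert a (insert b A) - {x} = insert a (insert b (A - {x}))"
      using assms that by auto
    then show ?thesis
      using assms by (simp add: P_def mult.assoc)
  qed
  have "insert a (insert b A) - {a} = insert b (A - {a})" "insert a (insert b A) - {b} = insert a (A - {b})"
    using assms by auto
  then have U: "(\<Prod>y\<in>insert a (insert b A) - {a}. a - y) = (a - b) * P a"
    "(\<Prod>y\<in>insert a (insert b A) - {b}. b - y) = (b - a) * P b"
    using assms by (simp_all add: P_def)
  have both: "lagrange_sum f (insert a (insert b A))
      = f a / ((a - b) * P a) + (f b / ((b - a) * P b) + (\<Sum>x\<in>A. f x / ((x - a) * (x - b) * P x)))"
  proof -
    define g where "g = (\<lambda>x. f x / (\<Prod>y\<in>insert a (insert b A) - {x}. x - y))"
    have "sum g (insert a (insert b A)) = g a + (g b + sum g A)"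
      using assms by simp
    moreover have "g a = f a / ((a - b) * P a)" "g b = f b / ((b - a) * P b)"
      by (simp_all only: g_def U)
    moreover have "sum g A = (\<Sum>x\<in>A. f x / ((x - a) * (x - b) * P x))"
      by (intro sum.cong refl) (simp only: g_def T)
    ultimately show ?thesis
      by (simp only: lagrange_sum_def g_def[symmetric])
  qed
  have "f x / ((x - a) * P x) - f x / ((x - b) * P x) = (a - b) * (f x / ((x - a) * (x - b) * P x))"
    if "x \<in> A" for x
  proof -
    have "x - a \<noteq> 0" "x - b \<noteq> 0"
      using that assms by auto
    then show ?thesis
      using P_nz[of x] by (simp add: divide_simps) (simp add: algebra_simps)
  qed
  then have "S a - S b = (a - b) * (\<Sum>x\<in>A. f x / ((x - a) * (x - b) * P x))"
    unfolding S_def by (simp add: sum_subtractf[symmetric] sum_distrib_left)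
  moreover have "(a - b) * (f a / ((a - b) * P a)) = f a / P a"
    "(a - b) * (f b / ((b - a) * P b)) = - (f b / P b)"
    using assms(2) P_nz by (simp_all add: divide_simps) (simp add: algebra_simps)
  ultimately show ?thesis
    unfolding both single[OF assms(3)] single[OF assms(4)] by (simp add: distrib_left)
qed

lemma divdiff_eq_lagrange_sum:
  "distinct xs \<Longrightarrow> xs \<noteq> [] \<Longrightarrow> divdiff f xs = lagrange_sum f (set xs)"
proof (induction f xs rule: divdiff.induct)
  case (2 f x)
  then show ?case
    by (simp add: lagrange_sum_def)
next
  case (3 f x y xs)
  then have "divdiff f (x # xs) - divdiff f (y # xs) = (x - y) * lagrange_sum f (set (x # y # xs))"
    using lagrange_sum_rec[of "set xs" x y f] by simp
  with 3 show ?case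
    by simp
qed simp

lemma divdiff_mset_cong:
  assumes "distinct xs" "mset xs = mset ys"
  shows "divdiff f xs = divdiff f ys"
proof -
  have "distinct ys" "set xs = set ys" "xs = [] \<longleftrightarrow> ys = []"
    using assms mset_eq_imp_distinct_iff mset_eq_setD by (blast, blast, auto)
  then show ?thesis
    using assms divdiff_eq_lagrange_sum[of xs f] divdiff_eq_lagrange_sum[of ys f] by (cases "xs = []") auto
qed

lemma divdiff_rec: "x \<noteq> y \<Longrightarrow> (x - y) * divdiff f (x # y # xs) = divdiff f (x # xs) - divdiff f (y # xs)"
  by simp

lemma divdiff_cong: "(\<And>x. x \<in> set xs \<Longrightarrow> f x = g x) \<Longrightarrow> divdiff f xs = divdiff g xs"
  by (induction f xs rule: divdiff.induct) auto

lemma divdiff_cmult: "divdiff (\<lambda>x. c * f x) xs = c * divdiff f xs"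
  by (induction f xs rule: divdiff.induct) (auto simp: right_diff_distrib)

subsection \<open>Continuous extension to coinciding nodes\<close>

text \<open>The points are chosen one after another; balls of the ring are infinite, so the points
  already used and the finite set \<open>S\<close> can be avoided.\<close>

lemma approx_injective_eps:
  fixes v :: "'j \<Rightarrow> 'a::local_field"
  assumes "finite J" "finite S" "e > 0" "\<And>j. j \<in> J \<Longrightarrow> v j \<in> valuation_ring"
  shows "\<exists>u. inj_on u J \<and> u ` J \<subseteq> valuation_ring - S \<and> (\<forall>j\<in>J. absval (u j - v j) < e)"
  using assms(1,4)
proof (induction J rule: finite_induct)
  case (insert j J)
  then obtain u where u: "inj_on u J" "u ` J \<subseteq> valuation_ring - S" "\<forall>j\<in>J. absval (u j - v j) < e"
    by auto
  obtain y where y: "y \<in> valuation_ring" "y \<notin> S \<union> u ` J" "absval (y - v j) < e"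
    using valuation_ring_approx[of "v j" e "S \<union> u ` J"] insert assms by auto
  have "inj_on (u(j := y)) (insert j J)" "u(j := y) ` insert j J \<subseteq> valuation_ring - S"
    "\<forall>i\<in>insert j J. absval ((u(j := y)) i - v i) < e"
    using u y insert.hyps by (auto simp: inj_on_def)
  then show ?case
    by blast
qed auto

text \<open>Identities between divided differences at distinct nodes are carried over to coinciding
  nodes along such sequences.\<close>

lemma approx_injective:
  fixes v :: "'j \<Rightarrow> 'a::local_field"
  assumes "finite J" "finite S" "\<And>j. j \<in> J \<Longrightarrow> v j \<in> valuation_ring"
  obtains u :: "nat \<Rightarrow> 'j \<Rightarrow> 'a"
  where "\<And>m. inj_on (u m) J" "\<And>m j. j \<in> J \<Longrightarrow> u m j \<in> valuation_ring - S"
    "\<And>j. j \<in> J \<Longrightarrow> (\<lambda>m. u m j) \<longlonglongrightarrow> v j"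
proof -
  have "\<forall>m. \<exists>u. inj_on u J \<and> u ` J \<subseteq> valuation_ring - S \<and>
      (\<forall>j\<in>J. absval (u j - v j) < inverse (real (Suc m)))"
    using assms by (intro allI approx_injective_eps) auto
  then obtain u where u: "\<And>m. inj_on (u m) J" "\<And>m. u m ` J \<subseteq> valuation_ring - S"
    "\<And>m j. j \<in> J \<Longrightarrow> absval (u m j - v j) < inverse (real (Suc m))"
    by metis
  have "(\<lambda>m. u m j) \<longlonglongrightarrow> v j" if "j \<in> J" for j
    unfolding tendsto_absval_iff
  proof (intro allI impI)
    fix e :: real assume "e > 0"
    with LIMSEQ_inverse_real_of_nat have "eventually (\<lambda>m. inverse (real (Suc m)) < e) sequentially"
      by (rule order_tendstoD(2))
    then show "eventually (\<lambda>m. absval (u m j - v j) < e) sequentially"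
      by eventually_elim (use u(3)[OF that] in \<open>auto intro: order_less_trans\<close>)
  qed
  with u show ?thesis
    by (intro that[of u]) auto
qed

text \<open>Turns continuity for the product topology into coordinatewise limits along any filter;
  \<open>continuous_map_tupleI\<close> is the converse passage.\<close>

lemma continuous_extension_tendsto:
  assumes "continuous_extension k f g"
    and "\<And>i. i < Suc k \<Longrightarrow> ((\<lambda>m. u m i) \<longlongrightarrow> v i) F"
    and "\<And>i. i < Suc k \<Longrightarrow> eventually (\<lambda>m. u m i \<in> valuation_ring) F"
    and "\<And>i. i < Suc k \<Longrightarrow> v i \<in> valuation_ring"
  shows "((\<lambda>m. g (\<lambda>i\<in>{..<Suc k}. u m i)) \<longlongrightarrow> g (\<lambda>i\<in>{..<Suc k}. v i)) F"
proof -
  let ?X = "product_topology (\<lambda>_. top_of_set (valuation_ring::'a set)) {..<Suc k}"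
  have "eventually (\<lambda>m. \<forall>i\<in>{..<Suc k}. u m i \<in> valuation_ring) F"
    using assms(3) by (intro eventually_ball_finite) auto
  then have "limitin ?X (\<lambda>m. \<lambda>i\<in>{..<Suc k}. u m i) (\<lambda>i\<in>{..<Suc k}. v i) F"
    unfolding limitin_componentwise
  proof (intro conjI ballI)
    show "eventually (\<lambda>m. (\<lambda>i\<in>{..<Suc k}. u m i) \<in> topspace ?X) F"
      if "eventually (\<lambda>m. \<forall>i\<in>{..<Suc k}. u m i \<in> valuation_ring) F"
      using that by eventually_elim auto
  qed (use assms in \<open>auto simp: limitin_subtopology\<close>)
  moreover have "continuous_map ?X euclidean g"
    using assms(1) by (simp add: continuous_extension_def)
  ultimately have "limitin euclidean (g \<circ> (\<lambda>m. \<lambda>i\<in>{..<Suc k}. u m i)) (g (\<lambda>i\<in>{..<Suc k}. v i)) F"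
    by (rule continuous_map_limit[rotated])
  then show ?thesis
    by (simp add: comp_def)
qed

lemma continuous_map_tupleI:
  fixes g :: "(nat \<Rightarrow> 'a::local_field) \<Rightarrow> 'a"
  assumes "\<And>x F. (\<And>i. i < Suc k \<Longrightarrow> ((\<lambda>y. y i) \<longlongrightarrow> x i) F) \<Longrightarrow>
      (\<And>i. i < Suc k \<Longrightarrow> eventually (\<lambda>y. y i \<in> valuation_ring) F) \<Longrightarrow>
      (\<And>i. i < Suc k \<Longrightarrow> x i \<in> valuation_ring) \<Longrightarrow> (g \<longlongrightarrow> g x) F"
  shows "continuous_map (product_topology (\<lambda>_. top_of_set valuation_ring) {..<Suc k}) euclidean g"
  unfolding continuous_map_atin limitin_canonical_iff
proof
  fix x :: "nat \<Rightarrow> 'a"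
  let ?X = "product_topology (\<lambda>_. top_of_set (valuation_ring::'a set)) {..<Suc k}"
  assume x: "x \<in> topspace ?X"
  have "limitin ?X (\<lambda>y. y) x (atin ?X x)"
    using limitin_continuous_map[OF continuous_map_id x] by (simp add: id_def)
  then have *: "limitin (top_of_set valuation_ring) (\<lambda>y. y i) (x i) (atin ?X x)" if "i < Suc k" for i
    using that unfolding limitin_componentwise by auto
  show "(g \<longlongrightarrow> g x) (atin ?X x)"
    by (rule assms) (use * in \<open>auto simp: limitin_subtopology\<close>)
qed

lemma restrict_in_nabla:
  assumes "distinct xs" "set xs \<subseteq> valuation_ring" "length xs = k"
  shows "(\<lambda>i\<in>{..<k}. xs ! i) \<in> nabla k"
  using assms by (auto simp: nabla_def inj_on_def distinct_conv_nth subset_iff)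

lemma map_restrict_nth: "length xs = k \<Longrightarrow> map (\<lambda>i\<in>{..<k}. xs ! i) [0..<k] = xs"
  by (auto intro: nth_equalityI)

lemma continuous_extension_eq_divdiff:
  assumes "continuous_extension k f g" "distinct xs" "set xs \<subseteq> valuation_ring" "length xs = Suc k"
  shows "g (\<lambda>i\<in>{..<Suc k}. xs ! i) = divdiff f xs"
  using assms(1) restrict_in_nabla[OF assms(2-4)] map_restrict_nth[OF assms(4)]
  by (simp add: continuous_extension_def diff_quot_eq_divdiff del: upt_Suc)

lemma continuous_extension_map_tendsto:
  assumes "continuous_extension k f g" "length js = Suc k"
    and "\<And>j. j \<in> set js \<Longrightarrow> ((\<lambda>m. u m j) \<longlongrightarrow> v j) F"
    and "\<And>j. j \<in> set js \<Longrightarrow> eventually (\<lambda>m. u m j \<in> valuation_ring) F"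
    and "\<And>j. j \<in> set js \<Longrightarrow> v j \<in> valuation_ring"
  shows "((\<lambda>m. g (\<lambda>i\<in>{..<Suc k}. map (u m) js ! i)) \<longlongrightarrow> g (\<lambda>i\<in>{..<Suc k}. map v js ! i)) F"
  by (rule continuous_extension_tendsto[OF assms(1)])
     (use assms in \<open>simp_all del: set_upt\<close>)

text \<open>Reads \<open>ext_diff_quot\<close> on lists, so that distinct and coinciding nodes share
  one notation; \<open>k + 1\<close> nodes belong to order \<open>k\<close>.\<close>

definition ext_divdiff :: "('a \<Rightarrow> 'a) \<Rightarrow> 'a list \<Rightarrow> 'a::local_field" where
  "ext_divdiff f xs = ext_diff_quot (length xs - 1) f (\<lambda>i\<in>{..<length xs}. xs ! i)"

lemma D_eq_ext_divdiff: "D j f x = ext_divdiff f (replicate (Suc j) x)"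
proof -
  have "(\<lambda>i\<in>{..<Suc j}. x) = (\<lambda>i\<in>{..<Suc j}. replicate (Suc j) x ! i)"
    by (intro restrict_ext) (simp del: replicate_Suc)
  then show ?thesis
    by (simp add: D_def ext_divdiff_def del: replicate_Suc)
qed

lemma continuous_extension_ext_diff_quot:
  "f \<in> C_fun k \<Longrightarrow> continuous_extension k f (ext_diff_quot k f)"
  by (simp add: C_fun_def ext_diff_quot_def someI_ex)

lemma ext_divdiff_eq_divdiff:
  assumes "f \<in> C_fun k" "length xs = Suc k" "distinct xs" "set xs \<subseteq> valuation_ring"
  shows "ext_divdiff f xs = divdiff f xs"
  using continuous_extension_eq_divdiff[OF continuous_extension_ext_diff_quot[OF assms(1)] assms(3,4,2)]
  by (simp add: ext_divdiff_def assms(2))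

lemma ext_divdiff_tendsto:
  assumes "f \<in> C_fun k" "length js = Suc k"
    and "\<And>j. j \<in> set js \<Longrightarrow> ((\<lambda>m. u m j) \<longlongrightarrow> v j) F"
    and "\<And>j. j \<in> set js \<Longrightarrow> eventually (\<lambda>m. u m j \<in> valuation_ring) F"
    and "\<And>j. j \<in> set js \<Longrightarrow> v j \<in> valuation_ring"
  shows "((\<lambda>m. ext_divdiff f (map (u m) js)) \<longlongrightarrow> ext_divdiff f (map v js)) F"
  using continuous_extension_map_tendsto[OF continuous_extension_ext_diff_quot[OF assms(1)] assms(2-5)]
  by (simp add: ext_divdiff_def assms(2))

text \<open>Pins down the choice made in \<open>ext_diff_quot\<close>: both sides are limits of the
  same divided differences at distinct nodes.\<close>

lemma ext_divdiff_unique: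
  assumes "continuous_extension k f g" "length xs = Suc k" "set xs \<subseteq> valuation_ring"
  shows "ext_divdiff f xs = g (\<lambda>i\<in>{..<Suc k}. xs ! i)"
proof -
  let ?js = "[0..<Suc k]"
  have f: "f \<in> C_fun k"
    using assms(1) by (auto simp: C_fun_def)
  have xs: "map (nth xs) ?js = xs"
    using assms(2) by (metis map_nth)
  have v: "xs ! j \<in> valuation_ring" if "j \<in> set ?js" for j
    using assms(2,3) that by (metis atLeastLessThan_iff nth_mem set_upt subset_iff)
  obtain u where u: "\<And>m. inj_on (u m) (set ?js)" "\<And>m j. j \<in> set ?js \<Longrightarrow> u m j \<in> valuation_ring - {}"
    "\<And>j. j \<in> set ?js \<Longrightarrow> (\<lambda>m. u m j) \<longlonglongrightarrow> xs ! j"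
    by (rule approx_injective[of "set ?js" "{}" "nth xs"]) (use v in auto)
  have d: "distinct (map (u m) ?js)" "set (map (u m) ?js) \<subseteq> valuation_ring" "length (map (u m) ?js) = Suc k" for m
    using u(1)[of m] u(2)[of _ m] by (auto simp: distinct_map simp del: upt_Suc)
  have "(\<lambda>m. ext_divdiff f (map (u m) ?js)) \<longlonglongrightarrow> ext_divdiff f (map (nth xs) ?js)"
    by (rule ext_divdiff_tendsto[OF f]) (use u v in \<open>auto simp del: upt_Suc\<close>)
  then have "(\<lambda>m. divdiff f (map (u m) ?js)) \<longlonglongrightarrow> ext_divdiff f xs"
    unfolding xs by (simp only: ext_divdiff_eq_divdiff[OF f d(3,1,2)])
  moreover have "(\<lambda>m. g (\<lambda>i\<in>{..<Suc k}. map (u m) ?js ! i)) \<longlonglongrightarrow> g (\<lambda>i\<in>{..<Suc k}. map (nth xs) ?js ! i)"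
    by (rule continuous_extension_map_tendsto[OF assms(1)]) (use u v in \<open>auto simp del: upt_Suc\<close>)
  then have "(\<lambda>m. divdiff f (map (u m) ?js)) \<longlonglongrightarrow> g (\<lambda>i\<in>{..<Suc k}. xs ! i)"
    unfolding xs by (simp only: continuous_extension_eq_divdiff[OF assms(1) d])
  ultimately show ?thesis
    by (rule LIMSEQ_unique)
qed

lemma ext_divdiff_mset_cong:
  assumes "f \<in> C_fun k" "length xs = Suc k" "set xs \<subseteq> valuation_ring" "mset xs = mset ys"
  shows "ext_divdiff f xs = ext_divdiff f ys"
proof -
  let ?js = "[0..<Suc k]"
  have xs: "map (nth xs) ?js = xs"
    using assms(2) by (metis map_nth)
  obtain p where p: "p permutes {..<length xs}" "permute_list p xs = ys"
    using mset_eq_permutation[OF assms(4)[symmetric]] by blast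
  \<comment> \<open>Positions are permuted instead of values: nodes may repeat, but one injective
    approximation \<open>u\<close> of the positions serves both lists.\<close>
  define ks where "ks = permute_list p ?js"
  have p': "p permutes {..<length ?js}"
    using p(1) assms(2) by simp
  have ys: "ys = map (nth xs) ks"
    using permute_list_map[OF p', of "nth xs"] p(2) by (simp only: xs ks_def)
  have m: "mset ks = mset ?js"
    unfolding ks_def using p' by simp
  have s: "set ks = set ?js"
    using m by (rule mset_eq_setD)
  have l: "length ks = Suc k" "length ?js = Suc k"
    using mset_eq_length[OF m] by simp_all
  have v: "xs ! j \<in> valuation_ring" if "j \<in> set ?js" for j
    using assms(2,3) that by (metis atLeastLessThan_iff nth_mem set_upt subset_iff)
  obtain u where u: "\<And>m. inj_on (u m) (set ?js)" "\<And>m j. j \<in> set ?js \<Longrightarrow> u m j \<in> valuation_ring - {}"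
    "\<And>j. j \<in> set ?js \<Longrightarrow> (\<lambda>m. u m j) \<longlonglongrightarrow> xs ! j"
    by (rule approx_injective[of "set ?js" "{}" "nth xs"]) (use v in auto)
  have "ext_divdiff f (map (u i) ?js) = ext_divdiff f (map (u i) ks)" for i
  proof -
    have "distinct ks"
      using mset_eq_imp_distinct_iff[OF m] by simp
    then have d: "distinct (map (u i) ?js)" "distinct (map (u i) ks)"
      using u(1)[of i] by (auto simp: distinct_map s simp del: upt_Suc set_upt)
    have r: "set (map (u i) ?js) \<subseteq> valuation_ring" "set (map (u i) ks) \<subseteq> valuation_ring"
      using u(2)[of _ i] by (auto simp: s simp del: upt_Suc set_upt)
    have "divdiff f (map (u i) ?js) = divdiff f (map (u i) ks)"
      by (rule divdiff_mset_cong[OF d(1)]) (simp only: mset_map m)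
    then show ?thesis
      using ext_divdiff_eq_divdiff[OF assms(1) _ d(1) r(1)] ext_divdiff_eq_divdiff[OF assms(1) _ d(2) r(2)] l by simp
  qed
  then have "(\<lambda>i. ext_divdiff f (map (u i) ?js)) = (\<lambda>i. ext_divdiff f (map (u i) ks))"
    by (rule ext)
  moreover have "(\<lambda>i. ext_divdiff f (map (u i) ?js)) \<longlonglongrightarrow> ext_divdiff f (map (nth xs) ?js)"
    by (rule ext_divdiff_tendsto[OF assms(1) l(2)]) (use u v in \<open>auto simp del: upt_Suc set_upt\<close>)
  moreover have "(\<lambda>i. ext_divdiff f (map (u i) ks)) \<longlonglongrightarrow> ext_divdiff f ys"
    unfolding ys
    by (rule ext_divdiff_tendsto[OF assms(1) l(1)]) (use u v s in \<open>auto simp del: upt_Suc set_upt\<close>)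
  ultimately show ?thesis
    unfolding xs by (simp only: LIMSEQ_unique)
qed

lemma continuous_extension_listI:
  assumes "continuous_map (product_topology (\<lambda>_. top_of_set valuation_ring) {..<Suc k}) euclidean
      (\<lambda>x. h (map x [0..<Suc k]))"
    and "\<And>xs. distinct xs \<Longrightarrow> set xs \<subseteq> valuation_ring \<Longrightarrow> length xs = Suc k \<Longrightarrow> h xs = divdiff f xs"
  shows "continuous_extension k f (\<lambda>x. h (map x [0..<Suc k]))"
  unfolding continuous_extension_def
proof (intro conjI ballI)
  fix x :: "nat \<Rightarrow> 'a" assume x: "x \<in> nabla (Suc k)"
  have "distinct (map x [0..<Suc k])" "set (map x [0..<Suc k]) \<subseteq> valuation_ring"
    using x by (auto simp: nabla_def distinct_map atLeast0LessThan simp del: upt_Suc)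
  with assms(2) show "h (map x [0..<Suc k]) = diff_quot k f x"
    by (simp add: diff_quot_eq_divdiff del: upt_Suc)
qed (rule assms(1))

section \<open>Lowering the order of differentiability\<close>

text \<open>The fixed nodes \<open>as\<close> are exchanged for those of \<open>xs\<close> one at a
  time; each exchange contributes an extended divided difference with one more node, so repeated
  entries of \<open>xs\<close> are allowed.\<close>

definition telescoped_divdiff :: "('a \<Rightarrow> 'a) \<Rightarrow> 'a list \<Rightarrow> 'a list \<Rightarrow> 'a::local_field" where
  "telescoped_divdiff f as xs =
     divdiff f as + (\<Sum>i<length as. (xs ! i - as ! i) * ext_divdiff f (take (Suc i) as @ drop i xs))"

lemma telescoped_divdiff_eq_divdiff:
  assumes f: "f \<in> C_fun (Suc k)" and len: "length as = Suc k" "length xs = Suc k"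
    and dist: "distinct (as @ xs)" and sub: "set (as @ xs) \<subseteq> valuation_ring"
  shows "telescoped_divdiff f as xs = divdiff f xs"
proof -
  \<comment> \<open>\<open>t\<close> passes from \<open>xs\<close> at \<open>i = 0\<close> to
    \<open>as\<close> at \<open>i = Suc k\<close>; neighbouring lists differ at position
    \<open>i\<close> only, so the recursion gives each difference.\<close>
  define t where "t = (\<lambda>i. divdiff f (take i as @ drop i xs))"
  have step: "(xs ! i - as ! i) * ext_divdiff f (take (Suc i) as @ drop i xs) = t i - t (Suc i)"
    if i: "i < Suc k" for i
  proof -
    define A where "A = take i as @ drop (Suc i) xs"
    have tk: "take (Suc i) as = take i as @ [as ! i]" "drop i xs = xs ! i # drop (Suc i) xs"
      using i len by (simp_all add: take_Suc_conv_app_nth Cons_nth_drop_Suc)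
    have m: "mset (take (Suc i) as @ drop i xs) = mset (xs ! i # as ! i # A)"
      "mset (take i as @ drop i xs) = mset (xs ! i # A)"
      "mset (take (Suc i) as @ drop (Suc i) xs) = mset (as ! i # A)"
      by (simp_all add: tk A_def)
    have d: "distinct (take (Suc i) as @ drop i xs)"
      using dist set_take_subset[of "Suc i" as] set_drop_subset[of i xs] by auto
    have d': "distinct (take i as @ drop i xs)" "distinct (take (Suc i) as @ drop (Suc i) xs)"
      using dist set_take_subset[of i as] set_take_subset[of "Suc i" as]
        set_drop_subset[of i xs] set_drop_subset[of "Suc i" xs] by auto
    have s: "set (take (Suc i) as @ drop i xs) \<subseteq> valuation_ring"
      using sub set_take_subset[of "Suc i" as] set_drop_subset[of i xs] by auto
    have l: "length (take (Suc i) as @ drop i xs) = Suc (Suc k)"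
      using i len by simp
    have ne: "xs ! i \<noteq> as ! i"
      using dist i len by (metis disjoint_iff distinct_append nth_mem)
    have "ext_divdiff f (take (Suc i) as @ drop i xs) = divdiff f (xs ! i # as ! i # A)"
      using ext_divdiff_eq_divdiff[OF f l d s] divdiff_mset_cong[OF d m(1)] by simp
    moreover have "t i = divdiff f (xs ! i # A)" "t (Suc i) = divdiff f (as ! i # A)"
      unfolding t_def by (rule divdiff_mset_cong[OF d'(1) m(2)], rule divdiff_mset_cong[OF d'(2) m(3)])
    ultimately show ?thesis
      using divdiff_rec[OF ne] by simp
  qed
  have "(\<Sum>i<Suc k. (xs ! i - as ! i) * ext_divdiff f (take (Suc i) as @ drop i xs)) = (\<Sum>i<Suc k. t i - t (Suc i))"
    by (intro sum.cong refl step) simp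
  also have "\<dots> = t 0 - t (Suc k)"
    by (rule sum_lessThan_telescope')
  finally show ?thesis
    by (simp add: telescoped_divdiff_def t_def len del: sum.lessThan_Suc)
qed

lemma telescoped_divdiff_tendsto:
  assumes f: "f \<in> C_fun (Suc k)" and as: "length as = Suc k" "set as \<subseteq> valuation_ring"
    and lim: "\<And>i. i < Suc k \<Longrightarrow> ((\<lambda>m. u m i) \<longlongrightarrow> v i) F"
    and ev: "\<And>i. i < Suc k \<Longrightarrow> eventually (\<lambda>m. u m i \<in> valuation_ring) F"
    and v: "\<And>i. i < Suc k \<Longrightarrow> v i \<in> valuation_ring"
  shows "((\<lambda>m. telescoped_divdiff f as (map (u m) [0..<Suc k])) \<longlongrightarrow> telescoped_divdiff f as (map v [0..<Suc k])) F"
  unfolding telescoped_divdiff_def as(1)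
proof (intro tendsto_add tendsto_const tendsto_sum tendsto_mult tendsto_diff)
  fix i assume "i \<in> {..<Suc k}"
  then have i: "i < Suc k"
    by simp
  then show "((\<lambda>m. map (u m) [0..<Suc k] ! i) \<longlongrightarrow> map v [0..<Suc k] ! i) F"
    using lim by (simp del: upt_Suc)
  \<comment> \<open>Fixed nodes are tagged \<open>Inl\<close> and moving positions
    \<open>Inr\<close>, so that a single \<open>map\<close> over \<open>js\<close> produces the
    mixed list.\<close>
  define js where "js = map Inl (take (Suc i) as) @ map Inr (drop i [0..<Suc k])"
  have map_js: "map (case_sum (\<lambda>x. x) y) js = take (Suc i) as @ drop i (map y [0..<Suc k])" for y :: "nat \<Rightarrow> 'a"
    by (simp add: js_def comp_def drop_map del: upt_Suc)
  have js: "set js \<subseteq> Inl ` valuation_ring \<union> Inr ` {..<Suc k}"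
    using as(2) set_take_subset[of "Suc i" as] by (auto simp: js_def simp del: upt_Suc)
  have "((\<lambda>m. ext_divdiff f (map (case_sum (\<lambda>x. x) (u m)) js)) \<longlongrightarrow> ext_divdiff f (map (case_sum (\<lambda>x. x) v) js)) F"
  proof (rule ext_divdiff_tendsto[OF f])
    show "length js = Suc (Suc k)"
      using i as by (simp add: js_def del: upt_Suc)
  next
    fix j assume "j \<in> set js"
    with js have "j \<in> Inl ` valuation_ring \<union> Inr ` {..<Suc k}"
      by blast
    then show "((\<lambda>m. case_sum (\<lambda>x. x) (u m) j) \<longlongrightarrow> case_sum (\<lambda>x. x) v j) F"
      "eventually (\<lambda>m. case_sum (\<lambda>x. x) (u m) j \<in> valuation_ring) F"
      "case_sum (\<lambda>x. x) v j \<in> valuation_ring"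
      using lim ev v by (auto simp del: lessThan_Suc)
  qed
  then show "((\<lambda>m. ext_divdiff f (take (Suc i) as @ drop i (map (u m) [0..<Suc k])))
      \<longlongrightarrow> ext_divdiff f (take (Suc i) as @ drop i (map v [0..<Suc k]))) F"
    unfolding map_js .
qed

lemma exists_distinct_list:
  assumes "finite (S :: 'a::local_field set)"
  shows "\<exists>as. length as = k \<and> distinct as \<and> set as \<subseteq> valuation_ring - S"
proof -
  obtain u :: "nat \<Rightarrow> nat \<Rightarrow> 'a" where
    u: "\<And>m. inj_on (u m) {..<k}" "\<And>m j. j \<in> {..<k} \<Longrightarrow> u m j \<in> valuation_ring - S"
    by (rule approx_injective[of "{..<k}" S "\<lambda>_. 0"])
       (use assms in \<open>auto simp: valuation_ring_def\<close>)
  show ?thesis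
    by (rule exI[of _ "map (u 0) [0..<k]"])
       (use u(1)[of 0] u(2)[of _ 0] in \<open>auto simp: distinct_map atLeast0LessThan\<close>)
qed

text \<open>
  The telescoped expression depends continuously on all of its second argument, but agrees with
  the divided difference only where that argument avoids the auxiliary nodes; comparing two
  disjoint sets of nodes removes this restriction.
\<close>

lemma C_fun_SucD:
  assumes f: "f \<in> C_fun (Suc k)"
  shows "f \<in> C_fun k"
proof -
  obtain as :: "'a list" where as: "length as = Suc k" "distinct as" "set as \<subseteq> valuation_ring - {}"
    using exists_distinct_list[of "{} :: 'a set" "Suc k"] by blast
  have as_ring: "set as \<subseteq> valuation_ring"
    using as(3) by auto
  have "continuous_extension k f (\<lambda>x. telescoped_divdiff f as (map x [0..<Suc k]))"
  proof (rule continuous_extension_listI)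
    show "continuous_map (product_topology (\<lambda>_. top_of_set valuation_ring) {..<Suc k}) euclidean
      (\<lambda>x. telescoped_divdiff f as (map x [0..<Suc k]))"
      by (intro continuous_map_tupleI telescoped_divdiff_tendsto f as as_ring)
  next
    fix xs :: "'a list"
    let ?js = "[0..<Suc k]"
    assume xs: "distinct xs" "set xs \<subseteq> valuation_ring" "length xs = Suc k"
    \<comment> \<open>\<open>as\<close> may meet \<open>xs\<close>, so the formula is known to be
      exact at \<open>xs\<close> only for \<open>bs\<close>. Along \<open>u\<close>, which avoids
      both families, the two expressions agree, hence also in the limit.\<close>
    obtain bs :: "'a list" where bs: "length bs = Suc k" "distinct bs" "set bs \<subseteq> valuation_ring - (set xs)"
      using exists_distinct_list[of "set xs" "Suc k"] by blast
    have bs_ring: "set bs \<subseteq> valuation_ring"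
      using bs by auto
    have map_xs: "map (nth xs) ?js = xs"
      using xs(3) by (metis map_nth)
    have v: "xs ! j \<in> valuation_ring" if "j < Suc k" for j
      using xs that nth_mem[of j xs] by auto
    obtain u where u: "\<And>m. inj_on (u m) (set ?js)"
      "\<And>m j. j \<in> set ?js \<Longrightarrow> u m j \<in> valuation_ring - (set as \<union> set bs)"
      "\<And>j. j \<in> set ?js \<Longrightarrow> (\<lambda>m. u m j) \<longlonglongrightarrow> xs ! j"
      by (rule approx_injective[of "set ?js" "set as \<union> set bs" "nth xs"]) (use v in auto)
    have lim: "(\<lambda>m. telescoped_divdiff f cs (map (u m) ?js)) \<longlonglongrightarrow> telescoped_divdiff f cs xs"
      if "length cs = Suc k" "set cs \<subseteq> valuation_ring" for cs
      using telescoped_divdiff_tendsto[OF f that, of u "nth xs" sequentially] u v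
      unfolding map_xs by (auto simp del: upt_Suc)
    have eq: "telescoped_divdiff f cs (map (u m) ?js) = divdiff f (map (u m) ?js)"
      if "cs = as \<or> cs = bs" for cs m
      by (rule telescoped_divdiff_eq_divdiff[OF f])
         (use that as bs as_ring u(1)[of m] u(2)[of _ m] in \<open>auto simp: distinct_map simp del: upt_Suc\<close>)
    have "telescoped_divdiff f as xs = telescoped_divdiff f bs xs"
      using LIMSEQ_unique[OF lim[OF as(1) as_ring]] lim[OF bs(1) bs_ring] by (simp only: eq simp_thms)
    also have "\<dots> = divdiff f xs"
      by (rule telescoped_divdiff_eq_divdiff[OF f]) (use bs xs in auto)
    finally show "telescoped_divdiff f as xs = divdiff f xs" .
  qed
  then show ?thesis
    by (auto simp: C_fun_def)
qed

lemma C_fun_antimono: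
  assumes "f \<in> C_fun k" "j \<le> k"
  shows "f \<in> C_fun j"
  using assms(2,1) by (induction rule: dec_induct) (auto intro: C_fun_SucD)

text \<open>Multiplied out, the recursion keeps its meaning for \<open>x = y\<close> and follows
  from the case of distinct nodes by a limit.\<close>

lemma ext_divdiff_rec:
  assumes f: "f \<in> C_fun (Suc (length xs))" and sub: "set (x # y # xs) \<subseteq> valuation_ring"
  shows "(x - y) * ext_divdiff f (x # y # xs) = ext_divdiff f (x # xs) - ext_divdiff f (y # xs)"
proof -
  define k where "k = length xs"
  define ks where "ks = [Suc (Suc 0)..<Suc (Suc k)]"
  let ?v = "nth (x # y # xs)"
  have ks: "set ks = {Suc (Suc 0)..<Suc (Suc k)}" "distinct ks" "length ks = k"
    by (auto simp: ks_def simp del: upt_Suc)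
  have map_ks: "map ?v ks = xs"
    by (intro nth_equalityI) (auto simp: ks_def k_def simp del: upt_Suc)
  let ?J = "{..<Suc (Suc k)}"
  have v: "?v j \<in> valuation_ring" if "j \<in> ?J" for j
    using sub nth_mem[of j "x # y # xs"] that by (simp only: k_def) (force simp del: nth_mem)
  obtain u where u: "\<And>m. inj_on (u m) ?J" "\<And>m j. j \<in> ?J \<Longrightarrow> u m j \<in> valuation_ring - {}"
    "\<And>j. j \<in> ?J \<Longrightarrow> (\<lambda>m. u m j) \<longlonglongrightarrow> ?v j"
    by (rule approx_injective[of ?J "{}" ?v]) (use v in auto)
  have f': "f \<in> C_fun k" "f \<in> C_fun (Suc k)"
    using f C_fun_SucD by (auto simp: k_def)
  have lim: "(\<lambda>m. ext_divdiff f (map (u m) js)) \<longlonglongrightarrow> ext_divdiff f (map ?v js)"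
    if "f \<in> C_fun i" "length js = Suc i" "set js \<subseteq> ?J" for js i
    by (rule ext_divdiff_tendsto[OF that(1,2)]) (use u v that(3) in auto)
  have eq: "ext_divdiff f (map (u m) js) = divdiff f (map (u m) js)"
    if "f \<in> C_fun i" "length js = Suc i" "set js \<subseteq> ?J" "distinct js" for js i m
    by (rule ext_divdiff_eq_divdiff[OF that(1)])
       (use that u(2)[of _ m] inj_on_subset[OF u(1)[of m] that(3)] in \<open>auto simp: distinct_map\<close>)
  have js: "set (0 # Suc 0 # ks) \<subseteq> ?J" "set (0 # ks) \<subseteq> ?J" "set (Suc 0 # ks) \<subseteq> ?J"
    "distinct (0 # Suc 0 # ks)" "distinct (0 # ks)" "distinct (Suc 0 # ks)"
    "length (0 # Suc 0 # ks) = Suc (Suc k)" "length (0 # ks) = Suc k" "length (Suc 0 # ks) = Suc k"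
    using ks by auto
  have L: "(\<lambda>m. (u m 0 - u m (Suc 0)) * ext_divdiff f (map (u m) (0 # Suc 0 # ks)))
      \<longlonglongrightarrow> (x - y) * ext_divdiff f (map ?v (0 # Suc 0 # ks))"
    using u(3)[of 0] u(3)[of "Suc 0"] by (intro tendsto_mult tendsto_diff lim[OF f'(2) js(7,1)]) auto
  have R: "(\<lambda>m. ext_divdiff f (map (u m) (0 # ks)) - ext_divdiff f (map (u m) (Suc 0 # ks)))
      \<longlonglongrightarrow> ext_divdiff f (map ?v (0 # ks)) - ext_divdiff f (map ?v (Suc 0 # ks))"
    by (intro tendsto_diff lim[OF f'(1) js(8,2)] lim[OF f'(1) js(9,3)])
  have "(u m 0 - u m (Suc 0)) * ext_divdiff f (map (u m) (0 # Suc 0 # ks))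
      = ext_divdiff f (map (u m) (0 # ks)) - ext_divdiff f (map (u m) (Suc 0 # ks))" for m
  proof -
    have "u m 0 \<noteq> u m (Suc 0)"
      using inj_onD[OF u(1)[of m], of 0 "Suc 0"] by auto
    then show ?thesis
      unfolding eq[OF f'(2) js(7,1,4)] eq[OF f'(1) js(8,2,5)] eq[OF f'(1) js(9,3,6)] by simp
  qed
  then have "(x - y) * ext_divdiff f (map ?v (0 # Suc 0 # ks)) = ext_divdiff f (map ?v (0 # ks)) - ext_divdiff f (map ?v (Suc 0 # ks))"
    using LIMSEQ_unique[OF L] R by simp
  moreover have "map ?v (0 # Suc 0 # ks) = x # y # xs" "map ?v (0 # ks) = x # xs"
    "map ?v (Suc 0 # ks) = y # xs"
    using map_ks by simp_all
  ultimately show ?thesis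
    by simp
qed

subsection \<open>Iterated derivatives\<close>

text \<open>Induction along the recursion: multiplied by \<open>x - y\<close>, every summand on the
  right splits by \<open>ext_divdiff_rec\<close>, up to a permutation of the nodes.\<close>

lemma divdiff_D_1:
  assumes "f \<in> C_fun (length ys)" "distinct ys" "set ys \<subseteq> valuation_ring"
  shows "divdiff (D 1 f) ys = (\<Sum>z\<leftarrow>ys. ext_divdiff f (z # ys))"
  using assms
proof (induction "D 1 f" ys rule: divdiff.induct)
  case (2 x)
  then show ?case
    by (simp add: D_eq_ext_divdiff)
next
  case (3 x y zs)
  have f: "f \<in> C_fun (Suc (length (w # zs)))" "f \<in> C_fun (length (w # zs))" for w
    using 3(3) C_fun_SucD by auto
  have perm: "ext_divdiff f as = ext_divdiff f bs"
    if "mset as = mset bs" "set as \<subseteq> insert x (insert y (set zs))"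
      "length as = Suc (Suc (length zs)) \<or> length as = Suc (Suc (Suc (length zs)))" for as bs
    using ext_divdiff_mset_cong[OF _ _ _ that(1)] f that(2,3) 3(5) by auto
  have sub: "set zs \<subseteq> insert x (insert y (set zs))"
    by auto
  have rec: "(x - y) * ext_divdiff f (x # y # z # zs) = ext_divdiff f (x # z # zs) - ext_divdiff f (y # z # zs)"
    if "z \<in> set (x # y # zs)" for z
    using ext_divdiff_rec[OF f(1)[of z]] 3(5) that by auto
  have "(x - y) * ext_divdiff f (z # x # y # zs) = ext_divdiff f (z # x # zs) - ext_divdiff f (z # y # zs)" if "z \<in> set zs" for z
    using rec[of z] perm[of "z # x # y # zs" "x # y # z # zs"] perm[of "z # x # zs" "x # z # zs"]
      perm[of "z # y # zs" "y # z # zs"] that sub by (simp add: add_mset_commute)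
  then have "(x - y) * (\<Sum>z\<leftarrow>zs. ext_divdiff f (z # x # y # zs))
      = (\<Sum>z\<leftarrow>zs. ext_divdiff f (z # x # zs) - ext_divdiff f (z # y # zs))"
    unfolding sum_list_const_mult[symmetric] by (intro arg_cong[where f = sum_list] map_cong) auto
  then have tail: "(x - y) * (\<Sum>z\<leftarrow>zs. ext_divdiff f (z # x # y # zs))
      = (\<Sum>z\<leftarrow>zs. ext_divdiff f (z # x # zs)) - (\<Sum>z\<leftarrow>zs. ext_divdiff f (z # y # zs))"
    by (simp add: sum_list_subtractf)
  \<comment> \<open>In the summands with \<open>z = x\<close> and \<open>z = y\<close> the term
    \<open>ext_divdiff f (x # y # zs)\<close> occurs with opposite signs and cancels.\<close>
  have heads: "(x - y) * ext_divdiff f (x # x # y # zs) = ext_divdiff f (x # x # zs) - ext_divdiff f (x # y # zs)"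
    "(x - y) * ext_divdiff f (y # x # y # zs) = ext_divdiff f (x # y # zs) - ext_divdiff f (y # y # zs)"
    using rec[of x] rec[of y] perm[of "x # x # y # zs" "x # y # x # zs"]
      perm[of "y # x # y # zs" "x # y # y # zs"] perm[of "y # x # zs" "x # y # zs"]
    using sub by (simp_all add: add_mset_commute)
  have "divdiff (D 1 f) (x # zs) = (\<Sum>z\<leftarrow>x # zs. ext_divdiff f (z # x # zs))"
    "divdiff (D 1 f) (y # zs) = (\<Sum>z\<leftarrow>y # zs. ext_divdiff f (z # y # zs))"
    using 3 f by auto
  then have "divdiff (D 1 f) (x # zs) - divdiff (D 1 f) (y # zs) = (x - y) * (\<Sum>z\<leftarrow>x # y # zs. ext_divdiff f (z # x # y # zs))"
    by (simp add: distrib_left tail heads)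
  with 3(4) show ?case
    by simp
qed simp

text \<open>The sum found for distinct nodes is continuous in all nodes; at equal nodes it has
  \<open>Suc k\<close> identical terms, which gives \<open>D_D_1\<close>.\<close>

lemma continuous_extension_D_1:
  assumes f: "f \<in> C_fun (Suc k)"
  shows "continuous_extension k (D 1 f) (\<lambda>x. (\<Sum>z\<leftarrow>map x [0..<Suc k]. ext_divdiff f (z # map x [0..<Suc k])))"
proof (rule continuous_extension_listI)
  let ?js = "[0..<Suc k]"
  have eq: "(\<Sum>z\<leftarrow>map x ?js. ext_divdiff f (z # map x ?js)) = (\<Sum>i<Suc k. ext_divdiff f (map x (i # ?js)))"
    for x :: "nat \<Rightarrow> 'a"
    by (simp add: sum_list_sum_nth atLeast0LessThan del: upt_Suc sum.lessThan_Suc)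
  show "continuous_map (product_topology (\<lambda>_. top_of_set valuation_ring) {..<Suc k}) euclidean
    (\<lambda>x. (\<Sum>z\<leftarrow>map x ?js. ext_divdiff f (z # map x ?js)))"
    unfolding eq
    by (intro continuous_map_tupleI tendsto_sum ext_divdiff_tendsto[OF f]) (auto simp del: upt_Suc)
qed (use divdiff_D_1[of f] f in auto)

lemma D_1_in_C_fun: "f \<in> C_fun (Suc k) \<Longrightarrow> D 1 f \<in> C_fun k"
  using continuous_extension_D_1 by (auto simp: C_fun_def)

lemma D_D_1:
  assumes "f \<in> C_fun (Suc k)" "x \<in> valuation_ring"
  shows "D k (D 1 f) x = of_nat (Suc k) * D (Suc k) f x"
proof -
  let ?xs = "replicate (Suc k) x"
  have "ext_divdiff (D 1 f) ?xs = (\<Sum>z\<leftarrow>map (\<lambda>i\<in>{..<Suc k}. ?xs ! i) [0..<Suc k].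
      ext_divdiff f (z # map (\<lambda>i\<in>{..<Suc k}. ?xs ! i) [0..<Suc k]))"
    by (rule ext_divdiff_unique[OF continuous_extension_D_1[OF assms(1)]]) (use assms in auto)
  also have "map (\<lambda>i\<in>{..<Suc k}. ?xs ! i) [0..<Suc k] = ?xs"
    by (rule map_restrict_nth) simp
  finally show ?thesis
    unfolding D_eq_ext_divdiff by (simp only: map_replicate sum_list_replicate replicate_Suc[symmetric])
qed

text \<open>Identities such as \<open>D 0 f x = f x\<close> are available for \<open>x\<close> in
  the valuation ring; this transports them through \<open>C_fun\<close> and
  \<open>D\<close>.\<close>

lemma continuous_extension_cong:
  assumes "\<And>x. x \<in> valuation_ring \<Longrightarrow> f x = f' x"
  shows "continuous_extension k f = continuous_extension k f'"
proof -
  have "diff_quot k f x = diff_quot k f' x" if "x \<in> nabla (Suc k)" for x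
    unfolding diff_quot_eq_divdiff
  proof (rule divdiff_cong)
    fix z assume "z \<in> set (map x [0..<Suc k])"
    then have "z \<in> x ` {..<Suc k}"
      by (simp only: set_map set_upt atLeast0LessThan)
    moreover have "x ` {..<Suc k} \<subseteq> valuation_ring"
      using that unfolding nabla_def by blast
    ultimately show "f z = f' z"
      using assms by blast
  qed
  then show ?thesis
    by (intro ext) (simp add: continuous_extension_def cong: ball_cong)
qed

lemma C_fun_cong:
  assumes "\<And>x. x \<in> valuation_ring \<Longrightarrow> f x = f' x"
  shows "f \<in> C_fun k \<longleftrightarrow> f' \<in> C_fun k"
proof -
  have "continuous_extension k f = continuous_extension k f'"
    using assms by (rule continuous_extension_cong)
  then show ?thesis
    by (simp only: C_fun_def mem_Collect_eq)
qed

lemma D_cong: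
  assumes "\<And>x. x \<in> valuation_ring \<Longrightarrow> f x = f' x"
  shows "D j f = D j f'"
  by (intro ext) (simp only: D_def ext_diff_quot_def continuous_extension_cong[of f f', OF assms])

lemma continuous_extension_cmult:
  assumes "continuous_extension k f g"
  shows "continuous_extension k (\<lambda>x. c * f x) (\<lambda>x. c * g x)"
  using assms
  unfolding continuous_extension_def diff_quot_eq_divdiff divdiff_cmult continuous_map_atin limitin_canonical_iff
  by (auto intro: tendsto_mult_left)

lemma C_fun_cmult: "f \<in> C_fun k \<Longrightarrow> (\<lambda>x. c * f x) \<in> C_fun k"
  using continuous_extension_cmult by (fastforce simp: C_fun_def)

lemma D_cmult:
  assumes "f \<in> C_fun j" "x \<in> valuation_ring"
  shows "D j (\<lambda>x. c * f x) x = c * D j f x"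
  using ext_divdiff_unique[OF continuous_extension_cmult[OF continuous_extension_ext_diff_quot[OF assms(1)]],
      of "replicate (Suc j) x" c] assms(2)
    ext_divdiff_unique[OF continuous_extension_ext_diff_quot[OF assms(1)], of "replicate (Suc j) x"]
  by (simp add: D_eq_ext_divdiff del: replicate_Suc)

lemma D_0:
  assumes "f \<in> C_fun k" "x \<in> valuation_ring"
  shows "D 0 f x = f x"
  using ext_divdiff_eq_divdiff[OF C_fun_antimono[OF assms(1), of 0], of "[x]"] assms(2) by (simp add: D_eq_ext_divdiff)

lemma D_tendsto:
  assumes "f \<in> C_fun j" "(u \<longlongrightarrow> x) F" "eventually (\<lambda>m. u m \<in> valuation_ring) F" "x \<in> valuation_ring"
  shows "((\<lambda>m. D j f (u m)) \<longlongrightarrow> D j f x) F"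
  using ext_divdiff_tendsto[OF assms(1), of "replicate (Suc j) ()" "\<lambda>m _. u m" "\<lambda>_. x" F] assms(2-4)
  by (simp add: D_eq_ext_divdiff map_replicate del: replicate_Suc)

text \<open>Induction on \<open>j\<close> through \<open>D (Suc j) f = D 1 (D j f) / (j + 1)\<close>
  on the ring. Smoothness and composition rule are carried together, since differentiating
  \<open>D j f\<close> requires its smoothness.\<close>

lemma D_D:
  fixes f :: "'a::local_field \<Rightarrow> 'a"
  assumes char: "CHAR('a) > 0 \<longrightarrow> n \<le> CHAR('a) - 1" and f: "f \<in> C_fun n" and "j \<le> n"
  shows "D j f \<in> C_fun (n - j) \<and>
    (\<forall>l\<le>n - j. \<forall>x\<in>valuation_ring. D l (D j f) x = of_nat (j + l choose j) * D (j + l) f x)"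
  using assms(3)
proof (induction j)
  case 0
  have eq: "D 0 f x = f x" if "x \<in> valuation_ring" for x
    by (rule D_0[OF f that])
  show ?case
    using C_fun_cong[of "D 0 f" f n] D_cong[of "D 0 f" f] eq f by simp
next
  case (Suc j)
  define g where "g = D 1 (D j f)"
  let ?c = "inverse (of_nat (Suc j)) :: 'a"
  have IH: "D j f \<in> C_fun (Suc (n - Suc j))"
    "\<And>l x. l \<le> n - j \<Longrightarrow> x \<in> valuation_ring \<Longrightarrow> D l (D j f) x = of_nat (j + l choose j) * D (j + l) f x"
    using Suc by (auto simp: Suc_diff_Suc)
  \<comment> \<open>A positive characteristic exceeds \<open>n\<close>, and
    \<open>Suc j \<le> n\<close>.\<close>
  have nz: "of_nat (Suc j) \<noteq> (0::'a)"
  proof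
    assume "of_nat (Suc j) = (0::'a)"
    then have "CHAR('a) dvd Suc j"
      by (simp only: of_nat_eq_0_iff_char_dvd)
    then have "CHAR('a) > 0" "CHAR('a) \<le> Suc j"
      by (auto dest: dvd_imp_le intro: Nat.gr0I)
    with char Suc.prems show False
      by linarith
  qed
  have eq: "D (Suc j) f x = ?c * g x" if "x \<in> valuation_ring" for x
    using IH(2)[of 1 x] Suc.prems that nz by (simp add: g_def field_simps del: of_nat_Suc)
  have g: "g \<in> C_fun (n - Suc j)"
    unfolding g_def using IH(1) by (rule D_1_in_C_fun)
  have "D l (D (Suc j) f) x = of_nat (Suc j + l choose Suc j) * D (Suc j + l) f x"
    if l: "l \<le> n - Suc j" and x: "x \<in> valuation_ring" for l x
  proof -
    have "D l (D (Suc j) f) x = D l (\<lambda>x. ?c * g x) x"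
      using D_cong[of "D (Suc j) f" "\<lambda>x. ?c * g x" l] eq by simp
    also have "\<dots> = ?c * D l g x"
      by (rule D_cmult[OF C_fun_antimono[OF g l] x])
    also have "D l g x = of_nat (Suc l) * D (Suc l) (D j f) x"
      unfolding g_def by (rule D_D_1[OF C_fun_antimono[OF IH(1)] x]) (use l in simp)
    also have "D (Suc l) (D j f) x = of_nat (j + Suc l choose j) * D (j + Suc l) f x"
      using l x Suc.prems by (intro IH(2)) auto
    finally have "of_nat (Suc j) * D l (D (Suc j) f) x
        = of_nat (Suc l * (j + Suc l choose j)) * D (Suc j + l) f x"
      by (simp only: mult.assoc[symmetric] right_inverse[OF nz] mult_1_left of_nat_mult
          add_Suc_right add_Suc)
    \<comment> \<open>Both sides equal \<open>(j + l + 1)! / (j! * l!)\<close>.\<close>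
    also have "Suc l * (j + Suc l choose j) = Suc j * (Suc j + l choose Suc j)"
      using binomial_absorb_comp[of "Suc j + l" j] Suc_times_binomial_add[of j l]
      by (simp add: add.commute mult.commute)
    finally show ?thesis
      by (simp only: of_nat_mult mult.assoc mult_left_cancel[OF nz])
  qed
  moreover have "D (Suc j) f \<in> C_fun (n - Suc j)"
    using C_fun_cong[of "D (Suc j) f" "\<lambda>x. ?c * g x"] eq C_fun_cmult[OF g] by simp
  ultimately show ?case
    by blast
qed

subsection \<open>Change of base point in Taylor polynomials\<close>

text \<open>The polynomial \<open>U\<close> of the overview with base point \<open>y\<close>;
  \<open>c\<close> takes the place of a coefficient of degree \<open>n + 1\<close>.\<close>

definition taylor :: "nat \<Rightarrow> 'a \<Rightarrow> ('a \<Rightarrow> 'a) \<Rightarrow> 'a \<Rightarrow> 'a \<Rightarrow> 'a::local_field" where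
  "taylor n c f y X = (\<Sum>l\<le>n. D l f y * (X - y) ^ l) + c * (X - y) ^ Suc n"

lemma taylor_self: "taylor n c f x x = D 0 f x"
  by (simp add: taylor_def power_0_left if_distrib[of "(*) _"] sum.delta cong: if_cong)

text \<open>Binomial expansion, then regrouping of the double sum over \<open>j + l \<le> n\<close>
  by the power of \<open>s\<close>.\<close>

lemma sum_recentre:
  fixes d :: "nat \<Rightarrow> 'a::comm_ring_1"
  shows "(\<Sum>l\<le>n. d l * (s + t) ^ l)
    = (\<Sum>j\<le>n. (\<Sum>l\<le>n - j. of_nat (j + l choose j) * d (j + l) * t ^ l) * s ^ j)"
proof -
  define g where "g = (\<lambda>j l. of_nat (j + l choose j) * d (j + l) * t ^ l * s ^ j)"
  have "(\<Sum>l\<le>n. d l * (s + t) ^ l) = (\<Sum>l\<le>n. \<Sum>j\<le>l. g j (l - j))"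
    unfolding binomial_ring sum_distrib_left
    by (intro sum.cong refl) (simp add: g_def ac_simps)
  also have "\<dots> = (\<Sum>(j, l)\<in>{(j, l). j + l \<le> n}. g j l)"
    by (rule sum.triangle_reindex_eq[symmetric])
  also have "{(j, l). j + l \<le> n} = (SIGMA j:{..n}. {..n - j})"
    by auto
  also have "(\<Sum>(j, l)\<in>(SIGMA j:{..n}. {..n - j}). g j l) = (\<Sum>j\<le>n. \<Sum>l\<le>n - j. g j l)"
    by (rule sum.Sigma[symmetric]) auto
  finally show ?thesis
    by (simp add: g_def sum_distrib_right)
qed

text \<open>\<open>D_D\<close> rewrites the iterated derivatives at \<open>y\<close>, so that
  clearing the denominator leaves the inner sums of \<open>sum_recentre\<close> with
  \<open>d l = D l f y\<close> and \<open>t = x - y\<close>.\<close>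

lemma psi_remainder:
  fixes f :: "'a::local_field \<Rightarrow> 'a"
  assumes "CHAR('a) > 0 \<longrightarrow> n \<le> CHAR('a) - 1" "f \<in> C_fun n" "j \<le> n" "y \<in> valuation_ring" "x \<noteq> y"
  shows "(psi (n - j) (D j f) x y - b) * (x - y) ^ (Suc n - j)
    = D j f x - (\<Sum>l\<le>n - j. of_nat (j + l choose j) * D (j + l) f y * (x - y) ^ l) - b * (x - y) ^ (Suc n - j)"
proof -
  have DD: "D l (D j f) y = of_nat (j + l choose j) * D (j + l) f y" if "l \<le> n - j" for l
    using D_D[OF assms(1-3)] assms(4) that by blast
  have "(\<Sum>l\<le>n - j. of_nat (j + l choose j) * D (j + l) f y * (x - y) ^ l)
      = D j f y + (\<Sum>l=1..n - j. (x - y) ^ l * D l (D j f) y)"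
    unfolding atMost_atLeast0 sum.atLeast_Suc_atMost[of 0 "n - j", OF le0]
    by (simp add: DD mult.commute)
  moreover have "psi (n - j) (D j f) x y * (x - y) ^ (Suc n - j)
      = D j f x - D j f y - (\<Sum>l=1..n - j. (x - y) ^ l * D l (D j f) y)"
    using assms(3,5) by (simp add: psi_def Suc_diff_le del: power_Suc)
  ultimately show ?thesis
    by (simp add: left_diff_distrib)
qed

text \<open>
  Changing the base point of the Taylor polynomial changes it by a polynomial whose coefficients
  are exactly the quantities that the hypothesis of the theorem controls.
\<close>

lemma taylor_diff:
  fixes f :: "'a::local_field \<Rightarrow> 'a"
  assumes "CHAR('a) > 0 \<longrightarrow> n \<le> CHAR('a) - 1" "f \<in> C_fun n" "y \<in> valuation_ring" "x \<noteq> y"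
  shows "taylor n c f x X - taylor n c f y X
    = (\<Sum>j\<le>n. (psi (n - j) (D j f) x y - of_nat (Suc n choose j) * c) * (x - y) ^ (Suc n - j) * (X - x) ^ j)"
proof -
  let ?s = "X - x" and ?t = "x - y"
  have y: "X - y = ?s + ?t"
    by simp
  have "(\<Sum>j\<le>n. (psi (n - j) (D j f) x y - of_nat (Suc n choose j) * c) * ?t ^ (Suc n - j) * ?s ^ j)
    = (\<Sum>j\<le>n. (D j f x - (\<Sum>l\<le>n - j. of_nat (j + l choose j) * D (j + l) f y * ?t ^ l)
         - of_nat (Suc n choose j) * c * ?t ^ (Suc n - j)) * ?s ^ j)"
    by (intro sum.cong refl) (simp only: psi_remainder[OF assms(1,2) _ assms(3,4)] atMost_iff)
  also have "\<dots> = (\<Sum>j\<le>n. D j f x * ?s ^ j) - (\<Sum>l\<le>n. D l f y * (X - y) ^ l)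
      - (\<Sum>j\<le>n. of_nat (Suc n choose j) * c * ?t ^ (Suc n - j) * ?s ^ j)"
    unfolding y sum_recentre by (simp only: left_diff_distrib sum_subtractf)
  \<comment> \<open>This is the binomial expansion of \<open>c * (?s + ?t) ^ Suc n\<close> without
    the term \<open>j = Suc n\<close>, which is the top term of the polynomial based at
    \<open>x\<close>.\<close>
  also have "(\<Sum>j\<le>n. of_nat (Suc n choose j) * c * ?t ^ (Suc n - j) * ?s ^ j)
      = c * (X - y) ^ Suc n - c * ?s ^ Suc n"
  proof -
    have "c * (X - y) ^ Suc n = (\<Sum>j\<le>Suc n. of_nat (Suc n choose j) * c * ?t ^ (Suc n - j) * ?s ^ j)"
      unfolding y binomial_ring sum_distrib_left by (intro sum.cong refl) (simp only: ac_simps)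
    then show ?thesis
      by (simp del: power_Suc binomial_Suc_Suc)
  qed
  finally show ?thesis
    by (simp add: taylor_def)
qed

text \<open>The exponents \<open>Suc n - j\<close> and \<open>j\<close> add up to
  \<open>Suc n\<close>, so all terms obey the same bound, and by the ultrametric inequality so does
  their sum.\<close>

lemma taylor_diff_less:
  fixes f :: "'a::local_field \<Rightarrow> 'a"
  assumes "CHAR('a) > 0 \<longrightarrow> n \<le> CHAR('a) - 1" "f \<in> C_fun n" "y \<in> valuation_ring" "x \<noteq> y"
    and "\<And>j. j \<le> n \<Longrightarrow> absval (psi (n - j) (D j f) x y - of_nat (Suc n choose j) * c) < \<epsilon>"
    and \<rho>: "\<rho> > 0" "absval (x - y) \<le> \<rho>" "absval (X - x) \<le> \<rho>"
  shows "absval (taylor n c f x X - taylor n c f y X) < \<epsilon> * \<rho> ^ Suc n"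
  unfolding taylor_diff[OF assms(1-4)]
proof (rule absval_sum_less)
  have "\<epsilon> > 0"
    using assms(5)[of 0] absval_nonneg order_le_less_trans by blast
  then show "\<epsilon> * \<rho> ^ Suc n > 0"
    using \<rho>(1) by simp
  fix j assume "j \<in> {..n}"
  then have j: "j \<le> n"
    by simp
  let ?e = "absval (psi (n - j) (D j f) x y - of_nat (Suc n choose j) * c)"
  have "absval (x - y) ^ (Suc n - j) * absval (X - x) ^ j \<le> \<rho> ^ (Suc n - j) * \<rho> ^ j"
    using \<rho> by (intro mult_mono power_mono) auto
  also have "\<dots> = \<rho> ^ Suc n"
    using j by (simp only: power_add[symmetric]) simp
  finally have "?e * (absval (x - y) ^ (Suc n - j) * absval (X - x) ^ j) \<le> ?e * \<rho> ^ Suc n"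
    by (intro mult_left_mono) auto
  also have "\<dots> < \<epsilon> * \<rho> ^ Suc n"
    using assms(5)[OF j] \<rho>(1) by (intro mult_strict_right_mono) auto
  finally show "absval ((psi (n - j) (D j f) x y - of_nat (Suc n choose j) * c) * (x - y) ^ (Suc n - j) * (X - x) ^ j)
      < \<epsilon> * \<rho> ^ Suc n"
    by (simp only: absval_mult absval_power mult.assoc)
qed

text \<open>By \<open>taylor_self\<close> the right-hand side is
  \<open>taylor n c f x x - taylor n c f y x\<close>, a difference that can be split along chains of
  base points.\<close>

lemma psi_taylor:
  fixes f :: "'a::local_field \<Rightarrow> 'a"
  assumes "f \<in> C_fun n" "x \<in> valuation_ring" "y \<in> valuation_ring" "x \<noteq> y"
  shows "(psi n f x y - c) * (x - y) ^ Suc n = D 0 f x - taylor n c f y x"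
proof -
  have "psi n f x y * (x - y) ^ Suc n = f x - f y - (\<Sum>l=1..n. (x - y) ^ l * D l f y)"
    using assms(4) by (simp add: psi_def del: power_Suc)
  moreover have "(\<Sum>l\<le>n. D l f y * (x - y) ^ l) = D 0 f y + (\<Sum>l=1..n. (x - y) ^ l * D l f y)"
    unfolding atMost_atLeast0 sum.atLeast_Suc_atMost[of 0 n, OF le0] by (simp add: mult.commute)
  ultimately show ?thesis
    using D_0[OF assms(1)] assms(2,3) by (simp add: taylor_def left_diff_distrib del: power_Suc)
qed

subsection \<open>Digit expansions\<close>

lemma uniformizer_absval:
  assumes "uniformizer (\<pi>::'a::local_field)"
  shows "0 < absval \<pi>" "absval \<pi> < 1"
proof -
  have eq: "{x. absval x < 1} = (\<lambda>x. \<pi> * x) ` valuation_ring"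
    using assms by (simp add: uniformizer_def)
  have "\<pi> * 1 \<in> (\<lambda>x. \<pi> * x) ` valuation_ring"
    by (intro imageI) (simp add: valuation_ring_def)
  then show "absval \<pi> < 1"
    unfolding eq[symmetric] by simp
  obtain x :: 'a where "x \<noteq> 0" "absval x < 1"
    using exists_small_nonzero by blast
  then have "x \<in> (\<lambda>x. \<pi> * x) ` valuation_ring"
    unfolding eq[symmetric] by simp
  then show "0 < absval \<pi>"
    using \<open>x \<noteq> 0\<close> by auto
qed

text \<open>No absolute value lies strictly between \<open>absval \<pi>\<close> and 1, so each
  correct digit gains a full factor \<open>absval \<pi>\<close>.\<close>

lemma uniformizer_absval_le:
  assumes "uniformizer (\<pi>::'a::local_field)" "absval (x::'a) < 1"
  shows "absval x \<le> absval \<pi>"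
proof -
  have "x \<in> (\<lambda>x. \<pi> * x) ` valuation_ring"
    using assms by (auto simp: uniformizer_def)
  then obtain w where "x = \<pi> * w" "absval w \<le> 1"
    by (auto simp: valuation_ring_def)
  then show ?thesis
    using mult_left_mono[of "absval w" 1 "absval \<pi>"] by (simp add: absval_mult)
qed

text \<open>Distinct representatives lie in different residue classes, so their difference is a
  unit.\<close>

lemma residue_representatives_absval:
  assumes "residue_representatives T" "s \<in> T" "t \<in> T" "s \<noteq> (t::'a::local_field)"
  shows "absval (s - t) = 1"
proof -
  have st: "s \<in> valuation_ring" "t \<in> valuation_ring"
    using assms by (auto simp: residue_representatives_def)
  have "\<exists>!r. r \<in> T \<and> r \<in> {y \<in> valuation_ring. absval (s - y) < 1}"
    using assms(1) residue_classI[OF st(1)] by (simp only: residue_representatives_def)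
  moreover have "s \<in> {y \<in> valuation_ring. absval (s - y) < 1}"
    using st by simp
  ultimately have "t \<notin> {y \<in> valuation_ring. absval (s - y) < 1}"
    using assms(2-4) by blast
  then have "absval (s - t) \<ge> 1"
    using st by simp
  moreover have "absval (s - t) \<le> 1"
    using st absval_diff_le[of s t] by (simp add: valuation_ring_def)
  ultimately show ?thesis
    by simp
qed

text \<open>The digit sequence is total and the length separate, so all prefixes of an expansion
  share \<open>d\<close>.\<close>

definition digit_sum :: "'a \<Rightarrow> (nat \<Rightarrow> 'a) \<Rightarrow> nat \<Rightarrow> 'a::field" where
  "digit_sum \<pi> d k = (\<Sum>i<k. d i * \<pi> ^ i)"

lemma digit_sum_Suc: "digit_sum \<pi> d (Suc k) = digit_sum \<pi> d k + d k * \<pi> ^ k"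
  by (simp add: digit_sum_def)

lemma digit_sum_diff: "digit_sum \<pi> (\<lambda>i. d i - e i) k = digit_sum \<pi> d k - digit_sum \<pi> e k"
  by (simp add: digit_sum_def left_diff_distrib sum_subtractf)

lemma digit_sum_cong: "(\<And>i. i < k \<Longrightarrow> d i = e i) \<Longrightarrow> digit_sum \<pi> d k = digit_sum \<pi> e k"
  by (simp add: digit_sum_def)

lemma absval_digit_sum_diff_le:
  assumes "absval (\<pi>::'a::local_field) \<le> 1" "\<And>i. d i \<in> valuation_ring" "m \<le> k"
  shows "absval (digit_sum \<pi> d k - digit_sum \<pi> d m) \<le> absval \<pi> ^ m"
  using assms(3)
proof (induction rule: dec_induct)
  case (step k)
  have "absval (d k * \<pi> ^ k) \<le> 1 * absval \<pi> ^ m"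
    unfolding absval_mult absval_power using assms(1) assms(2)[of k] step
    by (intro mult_mono power_decreasing) (auto simp: valuation_ring_def)
  with step show ?case
    by (simp add: digit_sum_Suc add_diff_eq[symmetric] add.commute[of "digit_sum \<pi> d k"] absval_add_le)
qed simp

lemma digit_sum_in_valuation_ring:
  assumes "absval (\<pi>::'a::local_field) \<le> 1" "\<And>i. d i \<in> valuation_ring"
  shows "digit_sum \<pi> d k \<in> valuation_ring"
  using absval_digit_sum_diff_le[OF assms, of 0 k] by (simp add: digit_sum_def valuation_ring_def)

text \<open>Successive approximation: the remainder divided by \<open>\<pi> ^ k\<close> is integral,
  and the representative of its residue class is the next digit.\<close>

lemma digit_sum_approx:
  assumes "uniformizer (\<pi>::'a::local_field)" "residue_representatives T" "0 \<in> T" "x \<in> valuation_ring"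
  shows "\<exists>d. (\<forall>i. d i \<in> T) \<and> absval (x - digit_sum \<pi> d k) \<le> absval \<pi> ^ k"
proof (induction k)
  case 0
  show ?case
    using assms(3,4) by (intro exI[of _ "\<lambda>_. 0"]) (simp add: digit_sum_def valuation_ring_def)
next
  case (Suc k)
  then obtain d where d: "\<And>i. d i \<in> T" "absval (x - digit_sum \<pi> d k) \<le> absval \<pi> ^ k"
    by blast
  have pos: "absval \<pi> > 0"
    using uniformizer_absval[OF assms(1)] by simp
  define z where "z = (x - digit_sum \<pi> d k) / \<pi> ^ k"
  have "z \<in> valuation_ring"
    using d(2) pos by (simp add: z_def valuation_ring_def absval_divide absval_power divide_simps)
  then have "\<exists>!t. t \<in> T \<and> t \<in> {y \<in> valuation_ring. absval (z - y) < 1}"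
    using assms(2) residue_classI[of z] by (simp only: residue_representatives_def)
  then obtain t where t: "t \<in> T" "absval (z - t) < 1"
    by auto
  have "x - digit_sum \<pi> (d(k := t)) (Suc k) = (z - t) * \<pi> ^ k"
  proof -
    have "digit_sum \<pi> (d(k := t)) k = digit_sum \<pi> d k"
      by (rule digit_sum_cong) simp
    moreover have "z * \<pi> ^ k = x - digit_sum \<pi> d k"
      using pos by (simp add: z_def)
    ultimately show ?thesis
      by (simp add: digit_sum_Suc left_diff_distrib)
  qed
  moreover have "absval (z - t) * absval \<pi> ^ k \<le> absval \<pi> * absval \<pi> ^ k"
    using uniformizer_absval_le[OF assms(1) t(2)] by (intro mult_right_mono) auto
  ultimately have "absval (x - digit_sum \<pi> (d(k := t)) (Suc k)) \<le> absval \<pi> ^ Suc k"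
    by (simp add: absval_mult absval_power)
  moreover have "\<forall>i. (d(k := t)) i \<in> T"
    using d(1) t(1) by simp
  ultimately show ?case
    by blast
qed

text \<open>The first differing digits differ by a unit, so position \<open>m\<close> contributes
  exactly \<open>absval \<pi> ^ m\<close>; all later positions together contribute at most
  \<open>absval \<pi> ^ Suc m\<close>.\<close>

lemma absval_digit_sum_diff_eq:
  assumes \<pi>: "uniformizer (\<pi>::'a::local_field)" and T: "residue_representatives T"
    and d: "\<And>i. d i \<in> T" and e: "\<And>i. e i \<in> T"
    and eq: "\<And>i. i < m \<Longrightarrow> d i = e i" and ne: "d m \<noteq> e m" and "m < k"
  shows "absval (digit_sum \<pi> d k - digit_sum \<pi> e k) = absval \<pi> ^ m"
proof -
  define c where "c = (\<lambda>i. d i - e i)"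
  have c: "c i \<in> valuation_ring" for i
  proof (cases "d i = e i")
    case False
    then show ?thesis
      using residue_representatives_absval[OF T d e] by (simp add: c_def valuation_ring_def)
  qed (simp add: c_def valuation_ring_def)
  have "digit_sum \<pi> c m = digit_sum \<pi> (\<lambda>_. 0) m"
    by (rule digit_sum_cong) (simp add: c_def eq)
  then have lead: "digit_sum \<pi> c (Suc m) = c m * \<pi> ^ m"
    by (simp add: digit_sum_Suc digit_sum_def)
  have abs_lead: "absval (digit_sum \<pi> c (Suc m)) = absval \<pi> ^ m"
    using residue_representatives_absval[OF T d e ne]
    unfolding lead absval_mult absval_power by (simp add: c_def)
  have "absval (digit_sum \<pi> c k - digit_sum \<pi> c (Suc m)) \<le> absval \<pi> ^ Suc m"
    using uniformizer_absval[OF \<pi>] c \<open>m < k\<close> by (intro absval_digit_sum_diff_le) auto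
  also have "\<dots> < absval \<pi> ^ m"
    using uniformizer_absval[OF \<pi>] by (intro power_strict_decreasing) auto
  finally have "absval (digit_sum \<pi> c (Suc m) + (digit_sum \<pi> c k - digit_sum \<pi> c (Suc m))) = absval \<pi> ^ m"
    using absval_add_eq abs_lead by metis
  then show ?thesis
    by (simp add: c_def digit_sum_diff)
qed

lemma digit_sum_ne_imp_first_difference:
  assumes "digit_sum \<pi> d k \<noteq> digit_sum \<pi> e k"
  obtains m where "m < k" "d m \<noteq> e m" "\<And>i. i < m \<Longrightarrow> d i = e i"
proof -
  have ex: "\<exists>i. i < k \<and> d i \<noteq> e i"
    using assms digit_sum_cong by metis
  define m where "m = (LEAST i. i < k \<and> d i \<noteq> e i)"
  have "m < k \<and> d m \<noteq> e m"
    unfolding m_def by (rule LeastI_ex[OF ex])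
  moreover have "d i = e i" if "i < m" for i
    using not_less_Least[OF that[unfolded m_def]] that calculation by auto
  ultimately show ?thesis
    using that by blast
qed

lemma digit_sum_inject:
  assumes "uniformizer (\<pi>::'a::local_field)" "residue_representatives T"
    and "\<And>i. d i \<in> T" "\<And>i. e i \<in> T"
    and "digit_sum \<pi> d k = digit_sum \<pi> e k" "i < k"
  shows "d i = e i"
proof (rule ccontr)
  assume "d i \<noteq> e i"
  define m where "m = (LEAST i. d i \<noteq> e i)"
  have m: "d m \<noteq> e m" "m \<le> i" "\<And>l. l < m \<Longrightarrow> d l = e l"
    using LeastI[of "\<lambda>i. d i \<noteq> e i", OF \<open>d i \<noteq> e i\<close>] Least_le[of "\<lambda>i. d i \<noteq> e i", OF \<open>d i \<noteq> e i\<close>]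
      not_less_Least by (auto simp: m_def)
  have "absval (digit_sum \<pi> d k - digit_sum \<pi> e k) = absval \<pi> ^ m"
    by (rule absval_digit_sum_diff_eq[OF assms(1-4)]) (use m assms(6) in auto)
  then show False
    using uniformizer_absval(1)[OF assms(1)] assms(5) by simp
qed

lemma digit_sum_extend_zero:
  assumes "k \<le> N"
  shows "digit_sum \<pi> (\<lambda>i. if i < k then d i else 0) N = digit_sum \<pi> d k"
  using assms
proof (induction rule: dec_induct)
  case base
  show ?case
    by (rule digit_sum_cong) simp
qed (simp add: digit_sum_Suc)

text \<open>Two expansions of the same element with nonzero top digits, padded with zeros to a
  common length, agree digit by digit; this makes the description in \<open>remove_leading\<close>
  unique.\<close>

lemma remove_leading_digit_sum:
  assumes \<pi>: "uniformizer (\<pi>::'a::local_field)" and T: "residue_representatives T" "0 \<in> T"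
    and d: "\<And>i. d i \<in> T" and lead: "d m \<noteq> 0"
  shows "remove_leading \<pi> T (digit_sum \<pi> d (Suc m)) = digit_sum \<pi> d m"
  unfolding remove_leading_def
proof (rule the_equality)
  show "\<exists>m' a. (\<forall>i\<le>m'. a i \<in> T) \<and> a m' \<noteq> 0 \<and> digit_sum \<pi> d (Suc m) = (\<Sum>i\<le>m'. a i * \<pi> ^ i)
      \<and> digit_sum \<pi> d m = (\<Sum>i<m'. a i * \<pi> ^ i)"
    using d lead by (intro exI[of _ m] exI[of _ d]) (simp only: digit_sum_def lessThan_Suc_atMost simp_thms)
next
  fix s
  assume "\<exists>m' a. (\<forall>i\<le>m'. a i \<in> T) \<and> a m' \<noteq> 0 \<and> digit_sum \<pi> d (Suc m) = (\<Sum>i\<le>m'. a i * \<pi> ^ i)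
      \<and> s = (\<Sum>i<m'. a i * \<pi> ^ i)"
  then obtain m' a where a: "\<And>i. i \<le> m' \<Longrightarrow> a i \<in> T" "a m' \<noteq> 0"
    "digit_sum \<pi> d (Suc m) = digit_sum \<pi> a (Suc m')" "s = digit_sum \<pi> a m'"
    unfolding digit_sum_def lessThan_Suc_atMost by blast
  define d' where "d' = (\<lambda>i. if i < Suc m then d i else 0)"
  define a' where "a' = (\<lambda>i. if i < Suc m' then a i else 0)"
  define N where "N = max (Suc m) (Suc m')"
  have "digit_sum \<pi> d' N = digit_sum \<pi> a' N"
    unfolding d'_def a'_def using a(3) by (subst (1 2) digit_sum_extend_zero) (auto simp: N_def)
  then have eq: "d' i = a' i" if "i < N" for i
    by (rule digit_sum_inject[OF \<pi> T(1), rotated 2]) (use d a T that in \<open>auto simp: d'_def a'_def\<close>)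
  \<comment> \<open>If the top positions differed, a padding zero would meet a nonzero digit at the
    larger one.\<close>
  have "d' m = a' m" "d' m' = a' m'"
    by (rule eq, simp add: N_def)+
  then have "m = m'"
    using lead a(2) by (auto simp: d'_def a'_def split: if_splits)
  moreover have "digit_sum \<pi> a m = digit_sum \<pi> d m" if "m = m'"
    by (rule digit_sum_cong) (use eq that in \<open>force simp: d'_def a'_def N_def\<close>)
  ultimately show "s = digit_sum \<pi> d m"
    using a(4) by simp
qed

lemma digit_sum_in_R_plus:
  assumes "\<And>i. d i \<in> T"
  shows "digit_sum \<pi> d (Suc k) \<in> R_plus \<pi> T"
  using assms by (auto simp: R_plus_def finite_expansions_def digit_sum_def intro!: bexI[of _ "Suc k"] simp del: sum.lessThan_Suc)

section \<open>Chains of prefixes and the final estimate\<close>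

text \<open>Digits are appended from position \<open>m\<close> on. Each nonzero digit is one use of
  \<open>hyp\<close>, and the ultrametric inequality keeps the bound independent of the number of
  steps.\<close>

lemma taylor_digit_chain:
  fixes f :: "'a::local_field \<Rightarrow> 'a"
  assumes char: "CHAR('a) > 0 \<longrightarrow> n \<le> CHAR('a) - 1" and f: "f \<in> C_fun n"
    and \<pi>: "uniformizer \<pi>" and T: "residue_representatives T" "0 \<in> T"
    and d: "\<And>i. d i \<in> T" and "\<epsilon> > 0"
    and hyp: "\<And>j r. \<lbrakk>j \<le> n; r \<in> R_plus \<pi> T; r \<noteq> 0;
           absval (r - a) < \<delta>; absval (remove_leading \<pi> T r - a) < \<delta>\<rbrakk>
         \<Longrightarrow> absval (psi (n - j) (D j f) r (remove_leading \<pi> T r) - of_nat (Suc n choose j) * c) < \<epsilon>"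
    and X: "\<And>k. m \<le> k \<Longrightarrow> absval (X - digit_sum \<pi> d k) \<le> absval \<pi> ^ m"
    and near: "\<And>k. m \<le> k \<Longrightarrow> absval (digit_sum \<pi> d k - a) < \<delta>"
    and "m \<le> N"
  shows "absval (taylor n c f (digit_sum \<pi> d N) X - taylor n c f (digit_sum \<pi> d m) X)
    < \<epsilon> * (absval \<pi> ^ m) ^ Suc n"
  using \<open>m \<le> N\<close>
proof (induction rule: dec_induct)
  case base
  show ?case
    using uniformizer_absval(1)[OF \<pi>] \<open>\<epsilon> > 0\<close> by (simp del: power_Suc)
next
  case (step k)
  let ?r = "digit_sum \<pi> d (Suc k)" and ?s = "digit_sum \<pi> d k"
  have dR: "d i \<in> valuation_ring" for i
    using d T(1) by (auto simp: residue_representatives_def)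
  have \<pi>1: "absval \<pi> \<le> 1"
    using uniformizer_absval(2)[OF \<pi>] by simp
  show ?case
  \<comment> \<open>A zero digit leaves the partial sum unchanged; a nonzero one is the leading
    digit of \<open>?r\<close>, and removing it gives \<open>?s\<close>.\<close>
  proof (cases "d k = 0")
    case True
    then show ?thesis
      using step.IH by (simp add: digit_sum_Suc del: power_Suc)
  next
    case False
    have rl: "remove_leading \<pi> T ?r = ?s"
      by (rule remove_leading_digit_sum[where d = d, OF \<pi> T d False])
    have nz: "?r \<noteq> 0"
    proof
      assume "?r = 0"
      then have "digit_sum \<pi> d (Suc k) = digit_sum \<pi> (\<lambda>_. 0) (Suc k)"
        by (simp add: digit_sum_def)
      then have "d k = 0"
        by (rule digit_sum_inject[OF \<pi> T(1), rotated 2]) (use d T in auto)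
      with False show False ..
    qed
    have "absval (taylor n c f ?r X - taylor n c f ?s X) < \<epsilon> * (absval \<pi> ^ m) ^ Suc n"
    proof (rule taylor_diff_less[OF char f])
      show "?s \<in> valuation_ring"
        by (rule digit_sum_in_valuation_ring[OF \<pi>1 dR])
      show "?r \<noteq> ?s"
        using False uniformizer_absval(1)[OF \<pi>] by (simp add: digit_sum_Suc)
      show "absval (psi (n - j) (D j f) ?r ?s - of_nat (Suc n choose j) * c) < \<epsilon>" if "j \<le> n" for j
        using hyp[OF that digit_sum_in_R_plus[of d, OF d] nz] near step.hyps unfolding rl by simp
      show "absval \<pi> ^ m > 0"
        using uniformizer_absval(1)[OF \<pi>] by simp
      have "absval (?r - ?s) \<le> absval \<pi> ^ k"
        by (rule absval_digit_sum_diff_le[OF \<pi>1 dR]) simp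
      also have "\<dots> \<le> absval \<pi> ^ m"
        using step.hyps \<pi>1 by (intro power_decreasing) auto
      finally show "absval (?r - ?s) \<le> absval \<pi> ^ m" .
      show "absval (X - ?r) \<le> absval \<pi> ^ m"
        using X step.hyps by simp
    qed
    from absval_add_less[OF this step.IH] show ?thesis
      by simp
  qed
qed

lemma taylor_tendsto:
  assumes "f \<in> C_fun n" "(u \<longlongrightarrow> x) F" "(w \<longlongrightarrow> y) F"
    and "eventually (\<lambda>m. w m \<in> valuation_ring) F" "y \<in> valuation_ring"
  shows "((\<lambda>m. taylor n c f (w m) (u m)) \<longlongrightarrow> taylor n c f y x) F"
  unfolding taylor_def
proof (intro tendsto_add tendsto_sum tendsto_mult tendsto_const tendsto_power_strong tendsto_diff assms)
  fix l assume "l \<in> {..n}"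
  then show "((\<lambda>m. D l f (w m)) \<longlongrightarrow> D l f y) F"
    using assms by (intro D_tendsto C_fun_antimono[OF assms(1)]) auto
qed

theorem theorem3p7:
  fixes \<pi> a c :: "'a::local_field"
    and T :: "'a set"
    and n :: nat
    and f :: "'a \<Rightarrow> 'a"
    and \<delta> \<epsilon> :: real
  assumes "uniformizer \<pi>"
    and "residue_representatives T" and "0 \<in> T"
    and "CHAR('a) > 0 \<longrightarrow> n \<le> CHAR('a) - 1"
    and "f \<in> C_fun n"
    and "a \<in> valuation_ring"
    and "\<delta> > 0" and "\<epsilon> > 0"
    and "\<And>j r. \<lbrakk>j \<le> n; r \<in> R_plus \<pi> T; r \<noteq> 0;
           absval (r - a) < \<delta>; absval (remove_leading \<pi> T r - a) < \<delta>\<rbrakk>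
         \<Longrightarrow> absval (psi (n - j) (D j f) r (remove_leading \<pi> T r)
                     - of_nat (Suc n choose j) * c) < \<epsilon>"
  shows "\<forall>x\<in>valuation_ring. \<forall>y\<in>valuation_ring.
           x \<noteq> y \<and> absval (x - a) < \<delta> \<and> absval (y - a) < \<delta>
           \<longrightarrow> absval (psi n f x y - c) < \<epsilon>"
proof (intro ballI impI, elim conjE)
  fix x y :: 'a
  assume x: "x \<in> valuation_ring" and y: "y \<in> valuation_ring" and "x \<noteq> y"
    and xa: "absval (x - a) < \<delta>" and ya: "absval (y - a) < \<delta>"
  note \<pi> = assms(1) and T = assms(2,3) and char = assms(4) and f = assms(5)
  define q where "q = absval (x - y)"
  have q: "q > 0"
    using \<open>x \<noteq> y\<close> by (simp add: q_def)
  have \<pi>1: "absval \<pi> \<le> 1" "absval \<pi> < 1" "absval \<pi> > 0"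
    using uniformizer_absval[OF \<pi>] by auto
  have TR: "t \<in> valuation_ring" if "t \<in> T" for t
    using that T(1) by (auto simp: residue_representatives_def)
  \<comment> \<open>The digit sequence may change with the length \<open>k\<close>;
    \<open>X k\<close> and \<open>Y k\<close> below are finite expansions converging to
    \<open>x\<close> and \<open>y\<close>.\<close>
  obtain d where d: "\<And>k i. d k i \<in> T" "\<And>k. absval (x - digit_sum \<pi> (d k) k) \<le> absval \<pi> ^ k"
    using digit_sum_approx[OF \<pi> T x] by metis
  obtain e where e: "\<And>k i. e k i \<in> T" "\<And>k. absval (y - digit_sum \<pi> (e k) k) \<le> absval \<pi> ^ k"
    using digit_sum_approx[OF \<pi> T y] by metis
  define X where "X = (\<lambda>k. digit_sum \<pi> (d k) k)"
  define Y where "Y = (\<lambda>k. digit_sum \<pi> (e k) k)"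
  have XY: "X k \<in> valuation_ring" "Y k \<in> valuation_ring" for k
    unfolding X_def Y_def by (intro digit_sum_in_valuation_ring[OF \<pi>1(1)] TR d e)+
  have small: "eventually (\<lambda>k. absval \<pi> ^ k < b) sequentially" if "b > 0" for b
    using \<pi>1 that by (intro order_tendstoD(2)[OF LIMSEQ_power_zero]) auto
  have close: "absval (X k - x) \<le> absval \<pi> ^ k" "absval (Y k - y) \<le> absval \<pi> ^ k" for k
    using d(2)[of k] e(2)[of k] by (simp_all add: X_def Y_def absval_minus_commute)
  have X_lim: "X \<longlonglongrightarrow> x" and Y_lim: "Y \<longlonglongrightarrow> y"
    unfolding tendsto_absval_iff
    using close by (auto intro: eventually_mono[OF small] order_le_less_trans)

  \<comment> \<open>For such \<open>k\<close> the expansions lie in the \<open>\<delta>\<close>-ball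
    around \<open>a\<close> and have the same distance \<open>q\<close> as \<open>x\<close> and
    \<open>y\<close>.\<close>
  have bound: "absval (D 0 f (X k) - taylor n c f (Y k) (X k)) < \<epsilon> * q ^ Suc n"
    if k: "absval \<pi> ^ k < min q \<delta>" for k
  proof -
    have kq: "absval (X k - x) < q" "absval (Y k - y) < q" "absval (X k - x) < \<delta>" "absval (Y k - y) < \<delta>"
      using close[of k] k by auto
    have "absval ((X k - x) - (Y k - y)) < absval (x - y)"
      using absval_diff_less[OF kq(1,2)] by (simp add: q_def)
    from absval_add_eq[OF this] have q_eq: "absval (X k - Y k) = q"
      by (simp add: q_def)
    have Xa: "absval (X k - a) < \<delta>" and Ya: "absval (Y k - a) < \<delta>"
      using absval_add_less[OF kq(3) xa] absval_add_less[OF kq(4) ya] by simp_all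
    \<comment> \<open>Two points of the \<open>\<delta>\<close>-ball are less than
      \<open>\<delta>\<close> apart, so nodes within \<open>q\<close> of \<open>X k\<close> stay in
      the ball.\<close>
    have q_less: "q < \<delta>"
      using absval_diff_less[OF Xa Ya] q_eq by simp
    have "X k \<noteq> Y k"
      using q_eq q by auto
    \<comment> \<open>The first differing position measures the distance,
      \<open>absval \<pi> ^ m = q\<close>; the common prefix \<open>P\<close> below is therefore
      within \<open>q\<close> of \<open>X k\<close>.\<close>
    then obtain m where m: "m < k" "d k m \<noteq> e k m" "\<And>i. i < m \<Longrightarrow> d k i = e k i"
      unfolding X_def Y_def by (rule digit_sum_ne_imp_first_difference) auto
    have pm: "absval \<pi> ^ m = q"
      using absval_digit_sum_diff_eq[of \<pi> T "d k" "e k", OF \<pi> T(1) d(1) e(1) m(3,2,1)] q_eq by (simp add: X_def Y_def)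
    define P where "P = digit_sum \<pi> (d k) m"
    have P: "P = digit_sum \<pi> (e k) m"
      unfolding P_def by (rule digit_sum_cong) (rule m(3))
    have XP: "absval (X k - P) \<le> q"
      using absval_digit_sum_diff_le[OF \<pi>1(1), of "d k" m k] TR d(1) m(1) pm by (simp add: X_def P_def)
    \<comment> \<open>\<open>g\<close> stands for either digit sequence, \<open>d k\<close> or
      \<open>e k\<close>.\<close>
    have dist: "absval (X k - digit_sum \<pi> g i) \<le> q"
      if "m \<le> i" "digit_sum \<pi> g m = P" "\<And>i. g i \<in> T" for g i
    proof -
      have "absval (digit_sum \<pi> g i - P) \<le> q"
        using absval_digit_sum_diff_le[OF \<pi>1(1), of g m i] TR that pm by simp
      then have "absval (X k - P - (digit_sum \<pi> g i - P)) \<le> q"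
        using XP absval_diff_le[of "X k - P" "digit_sum \<pi> g i - P"] by linarith
      then show ?thesis
        by simp
    qed
    have near: "absval (digit_sum \<pi> g i - a) < \<delta>"
      if "m \<le> i" "digit_sum \<pi> g m = P" "\<And>i. g i \<in> T" for g i
    proof -
      have "absval (X k - digit_sum \<pi> g i) < \<delta>"
        using dist[OF that] q_less by simp
      from absval_diff_less[OF Xa this] show ?thesis
        by simp
    qed
    have chain: "absval (taylor n c f (digit_sum \<pi> g k) (X k) - taylor n c f P (X k)) < \<epsilon> * q ^ Suc n"
      if "digit_sum \<pi> g m = P" "\<And>i. g i \<in> T" for g
    proof -
      have "absval (taylor n c f (digit_sum \<pi> g k) (X k) - taylor n c f (digit_sum \<pi> g m) (X k))
          < \<epsilon> * (absval \<pi> ^ m) ^ Suc n"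
        by (rule taylor_digit_chain[OF char f \<pi> T that(2) assms(8,9)])
           (use dist near that m(1) pm in auto)
      then show ?thesis
        by (simp only: that(1) pm)
    qed
    \<comment> \<open>Both chains start at \<open>P\<close> and are evaluated at the same point
      \<open>X k\<close>, so \<open>P\<close> cancels in their difference.\<close>
    have "absval (taylor n c f (X k) (X k) - taylor n c f P (X k)) < \<epsilon> * q ^ Suc n"
      "absval (taylor n c f (Y k) (X k) - taylor n c f P (X k)) < \<epsilon> * q ^ Suc n"
      unfolding X_def[THEN fun_cong, of k, THEN arg_cong[where f = "\<lambda>z. taylor n c f z (X k)"]]
        Y_def[THEN fun_cong, of k, THEN arg_cong[where f = "\<lambda>z. taylor n c f z (X k)"]]
      by (intro chain d(1) e(1) P_def[symmetric] P[symmetric])+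
    from absval_diff_less[OF this] show ?thesis
      by (simp add: taylor_self)
  qed

  have f0: "f \<in> C_fun 0"
    by (rule C_fun_antimono[OF f]) simp
  have "(\<lambda>k. D 0 f (X k) - taylor n c f (Y k) (X k)) \<longlonglongrightarrow> D 0 f x - taylor n c f y x"
    using XY x y by (intro tendsto_diff D_tendsto[OF f0] taylor_tendsto[OF f] X_lim Y_lim) auto
  moreover have "\<epsilon> * q ^ Suc n > 0"
    using \<open>\<epsilon> > 0\<close> q by simp
  ultimately have "eventually (\<lambda>k. absval (D 0 f (X k) - taylor n c f (Y k) (X k)
      - (D 0 f x - taylor n c f y x)) < \<epsilon> * q ^ Suc n) sequentially"
    unfolding tendsto_absval_iff by blast
  moreover have "eventually (\<lambda>k. absval \<pi> ^ k < min q \<delta>) sequentially"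
    using q \<open>\<delta> > 0\<close> by (intro small) simp
  \<comment> \<open>The estimate for \<open>X k\<close>, \<open>Y k\<close> and the approximation
    error both lie below the bound, hence so does their difference: the strict inequality survives
    the limit.\<close>
  ultimately have "eventually (\<lambda>k. absval (D 0 f x - taylor n c f y x) < \<epsilon> * q ^ Suc n) sequentially"
  proof eventually_elim
    case (elim k)
    from absval_diff_less[OF bound[OF elim(2)] elim(1)] show ?case
      by simp
  qed
  then have "absval (D 0 f x - taylor n c f y x) < \<epsilon> * q ^ Suc n"
    by simp
  then have "absval (psi n f x y - c) * q ^ Suc n < \<epsilon> * q ^ Suc n"
    unfolding psi_taylor[OF f x y \<open>x \<noteq> y\<close>, symmetric] by (simp only: absval_mult absval_power q_def)
  then show "absval (psi n f x y - c) < \<epsilon>"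
    using q by (simp only: mult_less_cancel_right_pos zero_less_power)
qed

end
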